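(* Assume all orthogonal rational functions $\phi_n^\alpha,\phi_n^\beta,\phi_n$ are orthonormal with positive leading coefficient, i.e. they have norm $1$ and $$\phi_n^{\alpha*}(\alpha_n)>0,\qquad \phi_n^{\beta*}(\beta_n)>0,\qquad\text{and}\qquad \begin{cases}(\phi_n^*/\dot B_n^\beta)(\alpha_n)>0 & \text{if }\gamma_n=\alpha_n,\\ (\phi_n^*/\dot B_n^\alpha)(\beta_n)>0 & \text{if }\gamma_n=\beta_n.\end{cases}$$ Then for all $n\ge 0$: if $\gamma_n=\alpha_n$, $$\phi_n=\phi_n^\alpha\,\dot B_n^\beta=(\phi_n^\beta)^*\,\dot B_n^\alpha\qquad\text{and}\qquad \phi_n^*=(\phi_n^\alpha)^*\,\dot B_n^\beta=\phi_n^\beta\,\dot B_n^\alpha,$$ while if $\gamma_n=\beta_n$, $$\phi_n=\phi_n^\beta\,\dot B_n^\alpha=(\phi_n^\alpha)^*\,\dot B_n^\beta\qquad\text{and}\qquad \phi_n^*=(\phi_n^\beta)^*\,\dot B_n^\alpha=\phi_n^\alpha\,\dot B_n^\beta.$$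
   Context: Notation: $\mathbb D$ is the open unit disk, $\mathbb T$ the unit circle, $\hat{\mathbb C}=\mathbb C\cup\{\infty\}$, $\mathbb E=\hat{\mathbb C}\setminus(\mathbb D\cup\mathbb T)$; $f_*(z)=\overline{f(1/\overline z)}$. Poles. $(\alpha_j)_{j\ge1}$ is an arbitrary sequence in $\mathbb D$, $\beta_j=1/\overline{\alpha}_j$ ($\beta_j=\infty$ if $\alpha_j=0$), $\alpha_0=0$, $\beta_0=\infty$. $(\gamma_j)_{j\ge0}$ is a sequence with $\gamma_j\in\{\alpha_j,\beta_j\}$ for each $j$, chosen arbitrarily. Put $\mathbb a_n=\{1\le j\le n:\gamma_j=\alpha_j\}$, $\mathbb b_n=\{1\le j\le n:\gamma_j=\beta_j\}$. Let $\sigma_j=\overline{\alpha}_j/|\alpha_j|$ if $\alpha_j\neq0$ and $\sigma_j=1$ if $\alpha_j=0$. For $\nu\in\{\alpha,\beta,\gamma\}$ let $\varpi_j^\nu(z)=1-\overline{\nu}_jz$ and $\varpi_j^{\nu*}(z)=z-\nu_j$ if $\nu_j\ne\infty$, and $\varpi_j^\nu(z)=-z$, $\varpi_j^{\nu*}(z)=-1$ if $\nu_j=\infty$; $\zeta_j^\nu=\sigma_j\varpi_j^{\nu*}/\varpi_j^\nu$. Blaschke products and spaces (empty products are $1$). $B_n^\nu=\prod_{j=1}^n\zeta_j^\nu$ for $\nu\in\{\alpha,\beta\}$; $\dot B_n^\alpha=\prod_{j\in\mathbb a_n}\zeta_j^\alpha$, $\dot B_n^\beta=\prod_{j\in\mathbb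 b_n}\zeta_j^\beta$; $B_0=1$ and, for $n\ge1$, $B_n=\dot B_n^\alpha$ if $\gamma_n=\alpha_n$, $B_n=\dot B_n^\beta$ if $\gamma_n=\beta_n$. $\mathcal L_n^\nu=\mathrm{span}\{B_0^\nu,\dots,B_n^\nu\}$ for $\nu\in\{\alpha,\beta\}$ and $\mathcal L_n=\mathrm{span}\{B_0,\dots,B_n\}$ for the sequence $\gamma$ (the superscript $\gamma$ is omitted). Orthogonality. $\mu$ is a probability measure positive a.e. on $\mathbb T$, $\langle f,g\rangle=\int_{\mathbb T}\overline{f}g\,d\mu$. For $\nu\in\{\alpha,\beta,\gamma\}$, $\phi_0^\nu=1$ and for $n\ge1$, $\phi_n^\nu\in\mathcal L_n^\nu\setminus\mathcal L_{n-1}^\nu$ with $\phi_n^\nu\perp\mathcal L_{n-1}^\nu$; $\phi_n=\phi_n^\gamma$. Reciprocals: $\phi_n^{\nu*}=(\phi_n^\nu)^*=B_n^\nu(\phi_n^\nu)_*$ for $\nu\in\{\alpha,\beta\}$ and $\phi_n^*=\dot B_n^\alpha\dot B_n^\beta(\phi_n)_*$. *)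

theory Defs
  imports "HOL-Analysis.Analysis" "HOL-Computational_Algebra.Computational_Algebra"
    "HOL-Computational_Algebra.Field_as_Ring" "HOL-Probability.Probability_Measure"
begin

section \<open>Rational functions on the Riemann sphere\<close>

text \<open>
  Rational functions are elements of the field \<open>\<complex>(z)\<close>, so equations between them are
  identities of rational functions, removable singularities are removed automatically, and no
  convention about division by zero enters.
\<close>

type_synonym ratfun = "complex poly fract"

definition ratC :: "complex \<Rightarrow> ratfun" where
  "ratC c = to_fract [:c:]"

definition ratX :: ratfun where
  "ratX = to_fract [:0, 1:]"

definition ratscale :: "complex \<Rightarrow> ratfun \<Rightarrow> ratfun" where
  "ratscale c f = ratC c * f"

global_interpretation ratfun: vector_space ratscale
proof
  have add: "ratC (a + b) = ratC a + ratC b" for a b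
    by (simp add: ratC_def flip: to_fract_add)
  have mult: "ratC (a * b) = ratC a * ratC b" for a b
    by (simp add: ratC_def flip: to_fract_mult)
  fix a b :: complex and x y :: ratfun
  show "ratscale a (x + y) = ratscale a x + ratscale a y"
    and "ratscale (a + b) x = ratscale a x + ratscale b x"
    and "ratscale a (ratscale b x) = ratscale (a * b) x"
    by (simp_all add: ratscale_def add mult algebra_simps)
  have "ratC 1 = 1"
    unfolding ratC_def one_pCons[symmetric] by simp
  then show "ratscale 1 x = x"
    by (simp add: ratscale_def)
qed

datatype sphere_pt = Pt complex | Infty

definition reflect_pt :: "complex \<Rightarrow> sphere_pt" where
  "reflect_pt a = (if a = 0 then Infty else Pt (1 / cnj a))"

text \<open>
  Evaluation uses the reduced representation \<open>p / q\<close>, so \<open>q\<close> vanishes exactly at the finite poles.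
  At \<open>\<infinity>\<close> the value is the limit of \<open>p / q\<close>; it is \<open>0\<close> if \<open>degree p < degree q\<close>,
  because then \<open>coeff p (degree q) = 0\<close>.
\<close>

fun rat_eval :: "ratfun \<Rightarrow> sphere_pt \<Rightarrow> sphere_pt" where
  "rat_eval f (Pt z) =
     (let (p, q) = quot_of_fract f
      in if poly q z = 0 then Infty else Pt (poly p z / poly q z))"
| "rat_eval f Infty =
     (let (p, q) = quot_of_fract f
      in if degree q < degree p then Infty else Pt (coeff p (degree q) / lead_coeff q))"

definition rat_fun :: "ratfun \<Rightarrow> complex \<Rightarrow> complex" where
  "rat_fun f z = (let (p, q) = quot_of_fract f in poly p z / poly q z)"

definition positive_at :: "ratfun \<Rightarrow> sphere_pt \<Rightarrow> bool" where
  "positive_at f w \<longleftrightarrow> (\<exists>r::real. r > 0 \<and> rat_eval f w = Pt (of_real r))"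

text \<open>
  The substar conjugate \<open>f\<^sub>*(z) = cnj (f (1 / cnj z))\<close>: for a polynomial \<open>p = \<Sum>c\<^sub>k z\<^sup>k\<close> it is
  \<open>\<Sum>(cnj c\<^sub>k) (1/z)\<^sup>k\<close>, computed in \<open>\<complex>(z)\<close>, and it is multiplicative on quotients.
\<close>

definition poly_substar :: "complex poly \<Rightarrow> ratfun" where
  "poly_substar p = poly (map_poly (\<lambda>c. ratC (cnj c)) p) (inverse ratX)"

definition substar :: "ratfun \<Rightarrow> ratfun" where
  "substar f = (let (p, q) = quot_of_fract f in poly_substar p / poly_substar q)"

section \<open>Blaschke products and the associated spaces\<close>

definition sigma :: "complex \<Rightarrow> complex" where
  "sigma a = (if a = 0 then 1 else cnj a / of_real (cmod a))"

fun varpi :: "sphere_pt \<Rightarrow> ratfun" where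
  "varpi (Pt v) = 1 - ratC (cnj v) * ratX"
| "varpi Infty = - ratX"

fun varpi_star :: "sphere_pt \<Rightarrow> ratfun" where
  "varpi_star (Pt v) = ratX - ratC v"
| "varpi_star Infty = - 1"

definition alpha_pt :: "(nat \<Rightarrow> complex) \<Rightarrow> nat \<Rightarrow> sphere_pt" where
  "alpha_pt \<alpha> j = Pt (\<alpha> j)"

definition beta_pt :: "(nat \<Rightarrow> complex) \<Rightarrow> nat \<Rightarrow> sphere_pt" where
  "beta_pt \<alpha> j = reflect_pt (\<alpha> j)"

text \<open>The sequence \<open>\<alpha>\<close> is a parameter because the unimodular factor is always that of \<open>\<alpha> j\<close>,
  whichever sequence \<open>\<nu>\<close> is used.\<close>

definition zeta :: "(nat \<Rightarrow> complex) \<Rightarrow> (nat \<Rightarrow> sphere_pt) \<Rightarrow> nat \<Rightarrow> ratfun" where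
  "zeta \<alpha> \<nu> j = ratC (sigma (\<alpha> j)) * varpi_star (\<nu> j) / varpi (\<nu> j)"

definition blaschke :: "(nat \<Rightarrow> complex) \<Rightarrow> (nat \<Rightarrow> sphere_pt) \<Rightarrow> nat \<Rightarrow> ratfun" where
  "blaschke \<alpha> \<nu> n = (\<Prod>j\<in>{1..n}. zeta \<alpha> \<nu> j)"

text \<open>The partial product over those \<open>j\<close> for which \<open>\<gamma> j\<close> was chosen to be \<open>\<nu> j\<close>.\<close>

definition blaschke_dot ::
  "(nat \<Rightarrow> complex) \<Rightarrow> (nat \<Rightarrow> sphere_pt) \<Rightarrow> (nat \<Rightarrow> sphere_pt) \<Rightarrow> nat \<Rightarrow> ratfun" where
  "blaschke_dot \<alpha> \<gamma> \<nu> n = (\<Prod>j\<in>{j\<in>{1..n}. \<gamma> j = \<nu> j}. zeta \<alpha> \<nu> j)"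

definition blaschke_gamma ::
  "(nat \<Rightarrow> complex) \<Rightarrow> (nat \<Rightarrow> sphere_pt) \<Rightarrow> nat \<Rightarrow> ratfun" where
  "blaschke_gamma \<alpha> \<gamma> n =
     (if n = 0 then 1
      else if \<gamma> n = alpha_pt \<alpha> n then blaschke_dot \<alpha> \<gamma> (alpha_pt \<alpha>) n
      else blaschke_dot \<alpha> \<gamma> (beta_pt \<alpha>) n)"

definition rat_space :: "(nat \<Rightarrow> ratfun) \<Rightarrow> nat \<Rightarrow> ratfun set" where
  "rat_space B n = ratfun.span (B ` {0..n})"

definition superstar :: "ratfun \<Rightarrow> ratfun \<Rightarrow> ratfun" where
  "superstar B f = B * substar f"

section \<open>Orthogonality\<close>

definition circle_borel :: "complex measure" where
  "circle_borel = restrict_space borel (sphere 0 1)"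

definition arc_length :: "complex measure" where
  "arc_length = distr (restrict_space lborel {0..<2 * pi}) circle_borel cis"

text \<open>A probability measure on the circle is positive almost everywhere if no Borel set of
  positive arc length is a null set of it, i.e. if the density of its absolutely continuous part
  is positive almost everywhere; a singular part is allowed.\<close>

definition circle_prob_positive_ae :: "complex measure \<Rightarrow> bool" where
  "circle_prob_positive_ae \<mu> \<longleftrightarrow>
     sets \<mu> = sets circle_borel \<and> prob_space \<mu> \<and> absolutely_continuous \<mu> arc_length"

definition rat_inner :: "complex measure \<Rightarrow> ratfun \<Rightarrow> ratfun \<Rightarrow> complex" where
  "rat_inner \<mu> f g = (\<integral>z. cnj (rat_fun f z) * rat_fun g z \<partial>\<mu>)"

definition orthonormal_rational ::
  "complex measure \<Rightarrow> (nat \<Rightarrow> ratfun) \<Rightarrow> (nat \<Rightarrow> ratfun) \<Rightarrow> bool" where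
  "orthonormal_rational \<mu> B \<phi> \<longleftrightarrow>
     \<phi> 0 = 1 \<and>
     (\<forall>n\<ge>1. \<phi> n \<in> rat_space B n - rat_space B (n - 1) \<and>
             (\<forall>g\<in>rat_space B (n - 1). rat_inner \<mu> (\<phi> n) g = 0)) \<and>
     (\<forall>n. rat_inner \<mu> (\<phi> n) (\<phi> n) = 1)"

end

theory Submission
  imports Defs
begin

text \<open>
  Replacing \<open>\<gamma>\<^sub>j = \<alpha>\<^sub>j\<close> by \<open>\<gamma>\<^sub>j = \<beta>\<^sub>j\<close> multiplies the spaces by a function of
  modulus one on the circle, and orthonormality does not see such a factor.

  The Blaschke factor of a reflected point is the reciprocal of the original one, and the factors
  are unimodular on the circle. Therefore the space of rational functions belonging to a choice
  \<open>\<gamma>\<close> is the space \<open>{p / \<Prod>(1 - cnj \<alpha>\<^sub>j z) | degree p \<le> n}\<close> multiplied by the unimodular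
  product \<open>D\<beta>\<close> of the reciprocal factors that were chosen (\<open>rat_space_blaschke_gamma\<close>). Only
  the inclusion needs a computation; equality follows by counting dimensions
  (\<open>rat_space_eq_polynomial_multiples\<close>).

  Two choices \<open>\<gamma>\<close>, \<open>\<gamma>'\<close> that agree at \<open>n\<close> have spaces related by one and the same
  unimodular factor at the stages \<open>n\<close> and \<open>n - 1\<close>. Multiplication by it maps
  \<open>\<phi>\<^sub>n\<close> to a function that is orthonormal in the sense of \<open>\<gamma>'\<close>, and such functions are
  unique up to a phase (\<open>unique_up_to_phase\<close>); the positivity normalization makes the phase
  \<open>1\<close> (\<open>phi_eq_if_same_choice\<close>). Comparison with the constant choice \<open>\<gamma>' = \<alpha>\<close> or
  \<open>\<gamma>' = \<beta>\<close> gives \<open>\<phi>\<^sub>n = \<phi>\<alpha>\<^sub>n D\<beta>\<^sub>n\<close> in the case \<open>\<gamma>\<^sub>n = \<alpha>\<^sub>n\<close> and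
  \<open>\<phi>\<^sub>n = \<phi>\<beta>\<^sub>n D\<alpha>\<^sub>n\<close> in the case \<open>\<gamma>\<^sub>n = \<beta>\<^sub>n\<close>.

  The remaining identities come from \<open>\<phi>\<beta>\<^sub>n = substar \<phi>\<alpha>\<^sub>n\<close>
  (\<open>phi_beta_eq_substar_phi_alpha\<close>), which has the same proof with conjugation in the place of the
  unimodular factor. Conjugation is the reflection in the circle, so it carries positivity at
  \<open>\<alpha>\<^sub>n\<close> to positivity at \<open>\<beta>\<^sub>n\<close>, including the case \<open>\<alpha>\<^sub>n = 0\<close>, \<open>\<beta>\<^sub>n = \<infinity>\<close>.
\<close>

section \<open>Constants, reduced quotients and values\<close>

lemma ratC_0 [simp]: "ratC 0 = 0"
  and ratC_1 [simp]: "ratC 1 = 1"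
  by (simp_all add: ratC_def flip: one_pCons)

lemma ratC_add: "ratC (a + b) = ratC a + ratC b"
  and ratC_mult: "ratC (a * b) = ratC a * ratC b"
  by (simp_all add: ratC_def flip: to_fract_add to_fract_mult)

lemma ratC_uminus: "ratC (- a) = - ratC a"
  by (simp add: ratC_def flip: to_fract_uminus)

lemma ratC_eq_0_iff [simp]: "ratC a = 0 \<longleftrightarrow> a = 0"
  by (simp add: ratC_def)

lemma ratC_inverse: "ratC (inverse a) = inverse (ratC a)"
proof (cases "a = 0")
  case False
  then have "ratC (inverse a) * ratC a = 1"
    by (simp flip: ratC_mult)
  then show ?thesis
    by (metis inverse_unique mult.commute)
qed simp

lemma ratX_nonzero [simp]: "ratX \<noteq> 0"
  by (simp add: ratX_def)

lemma to_fract_pCons: "to_fract (pCons a p) = ratC a + ratX * to_fract p"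
  by (simp add: ratC_def ratX_def flip: to_fract_add to_fract_mult)

lemma to_fract_smult: "to_fract (smult c p) = ratC c * to_fract p"
  unfolding ratC_def by (simp flip: to_fract_mult)

lemma to_fract_monom: "to_fract (monom c n) = ratC c * ratX ^ n"
  by (induction n) (simp_all add: monom_0 monom_Suc to_fract_pCons ratC_def[symmetric])

lemma quot_of_fractD:
  fixes f :: ratfun
  assumes "quot_of_fract f = (p, q)"
  shows "coprime p q" "q \<noteq> 0" "f = to_fract p / to_fract q"
proof -
  have "(p, q) \<in> normalized_fracts"
    by (metis assms quot_of_fract_in_normalized_fracts)
  then show "coprime p q" "q \<noteq> 0"
    by (auto simp: normalized_fracts_def)
  show "f = to_fract p / to_fract q"
    by (metis assms quot_to_fract_quot_of_fract quot_to_fract_def case_prod_conv Fract_conv_to_fract)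
qed

lemma quot_of_fract_cases:
  fixes f :: ratfun
  obtains p q where "quot_of_fract f = (p, q)" "coprime p q" "q \<noteq> 0" "f = to_fract p / to_fract q"
  by (metis quot_of_fractD surj_pair)

text \<open>
  In contrast to evaluation, this relation may use any representation \<open>p / q\<close> with
  \<open>q\<close> nonzero at \<open>z\<close>, not just the reduced one. It is therefore visibly preserved by
  the field operations.
\<close>

definition has_value :: "ratfun \<Rightarrow> complex \<Rightarrow> complex \<Rightarrow> bool" where
  "has_value f z v \<longleftrightarrow>
     (\<exists>p q. f = to_fract p / to_fract q \<and> poly q z \<noteq> 0 \<and> v = poly p z / poly q z)"

lemma cross_multiply:
  fixes p q p' q' :: "complex poly"
  assumes "f = to_fract p / to_fract q" "f = to_fract p' / to_fract q'" "q \<noteq> 0" "q' \<noteq> 0"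
  shows "p * q' = p' * q"
proof -
  have "to_fract p / to_fract q = to_fract p' / to_fract q'"
    using assms(1,2) by (rule subst)
  then have "to_fract (p * q') = to_fract (p' * q)"
    using assms(3,4) by (simp add: frac_eq_eq)
  then show ?thesis by (simp only: to_fract_eq_iff)
qed

text \<open>
  If the reduced denominator vanished at \<open>z\<close>, cross-multiplication with the given
  representation would force the reduced numerator to vanish there too, so both would be
  divisible by the linear factor of \<open>z\<close>, against coprimality.
\<close>

lemma has_value_quot_of_fract:
  assumes "has_value f z v" "quot_of_fract f = (p, q)"
  shows "poly q z \<noteq> 0" "v = poly p z / poly q z"
proof -
  obtain p' q' where q': "f = to_fract p' / to_fract q'" "poly q' z \<noteq> 0"
    and v: "v = poly p' z / poly q' z"
    using assms(1) unfolding has_value_def by blast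
  note red = quot_of_fractD[OF assms(2)]
  have "p * q' = p' * q"
    using q'(2) by (intro cross_multiply[OF red(3) q'(1) red(2)]) auto
  then have eq: "poly p z * poly q' z = poly p' z * poly q z"
    by (metis poly_mult)
  show "poly q z \<noteq> 0"
  proof
    assume "poly q z = 0"
    with eq q' have "poly p z = 0" by simp
    with \<open>poly q z = 0\<close> have "[:-z, 1:] dvd p" "[:-z, 1:] dvd q"
      by (simp_all add: poly_eq_0_iff_dvd)
    with red(1) have "is_unit [:-z, 1:]"
      by (meson coprime_def)
    then show False
      by (simp add: is_unit_iff_degree)
  qed
  with eq q'(2) show "v = poly p z / poly q z"
    unfolding v by (simp add: frac_eq_eq)
qed

lemma rat_eval_Pt_iff: "rat_eval f (Pt z) = Pt v \<longleftrightarrow> has_value f z v"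
proof -
  obtain p q where pq: "quot_of_fract f = (p, q)" "f = to_fract p / to_fract q"
    using quot_of_fract_cases[of f] .
  have "rat_eval f (Pt z) = Pt v" if "has_value f z v"
    using has_value_quot_of_fract[OF that pq(1)] pq(1) by simp
  moreover have "has_value f z v" if "rat_eval f (Pt z) = Pt v"
    using that pq unfolding has_value_def by (auto split: if_splits)
  ultimately show ?thesis by blast
qed

lemma rat_fun_eqI: "has_value f z v \<Longrightarrow> rat_fun f z = v"
  using has_value_quot_of_fract[of f z v] unfolding rat_fun_def
  by (cases "quot_of_fract f") simp

lemma has_value_to_fract: "has_value (to_fract p) z (poly p z)"
  unfolding has_value_def by (intro exI[of _ p] exI[of _ 1]) simp

lemma has_value_ratC: "has_value (ratC c) z c"
  using has_value_to_fract[of "[:c:]" z] by (simp add: ratC_def)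

lemma has_value_ratX: "has_value ratX z z"
  using has_value_to_fract[of "[:0, 1:]" z] by (simp add: ratX_def)

lemma has_value_add:
  assumes "has_value f z u" "has_value g z v"
  shows "has_value (f + g) z (u + v)"
proof -
  obtain a b c d where *: "f = to_fract a / to_fract b" "poly b z \<noteq> 0" "u = poly a z / poly b z"
      "g = to_fract c / to_fract d" "poly d z \<noteq> 0" "v = poly c z / poly d z"
    using assms unfolding has_value_def by auto
  then have "b \<noteq> 0" "d \<noteq> 0" by auto
  with * show ?thesis
    unfolding has_value_def
    by (intro exI[of _ "a * d + c * b"] exI[of _ "b * d"]) (simp add: add_frac_eq)
qed

lemma has_value_mult:
  assumes "has_value f z u" "has_value g z v"
  shows "has_value (f * g) z (u * v)"
proof -
  obtain a b c d where *: "f = to_fract a / to_fract b" "poly b z \<noteq> 0" "u = poly a z / poly b z"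
      "g = to_fract c / to_fract d" "poly d z \<noteq> 0" "v = poly c z / poly d z"
    using assms unfolding has_value_def by auto
  then show ?thesis
    unfolding has_value_def
    by (intro exI[of _ "a * c"] exI[of _ "b * d"]) simp
qed

lemma has_value_inverse:
  assumes "has_value f z v" "v \<noteq> 0"
  shows "has_value (inverse f) z (inverse v)"
proof -
  obtain p q where "f = to_fract p / to_fract q" "poly q z \<noteq> 0" "v = poly p z / poly q z"
    using assms unfolding has_value_def by auto
  with assms(2) show ?thesis
    unfolding has_value_def by (intro exI[of _ q] exI[of _ p]) auto
qed

lemma has_value_divide:
  "has_value f z u \<Longrightarrow> has_value g z v \<Longrightarrow> v \<noteq> 0 \<Longrightarrow> has_value (f / g) z (u / v)"
  unfolding divide_inverse by (intro has_value_mult has_value_inverse)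

lemma has_value_uminus: "has_value f z v \<Longrightarrow> has_value (- f) z (- v)"
  using has_value_mult[OF has_value_ratC[of "-1" z], of f v] by (simp add: ratC_uminus)

lemma has_value_diff:
  "has_value f z u \<Longrightarrow> has_value g z v \<Longrightarrow> has_value (f - g) z (u - v)"
  using has_value_add[OF _ has_value_uminus, of f z u g v] by simp

lemma coeff_mult_top:
  fixes p q :: "complex poly"
  assumes "degree p \<le> m" "degree q \<le> n"
  shows "coeff (p * q) (m + n) = coeff p m * coeff q n"
proof (cases "degree p = m \<and> degree q = n")
  case True
  then show ?thesis by (metis coeff_mult_degree_sum)
next
  case False
  then have "degree (p * q) < m + n" if "p \<noteq> 0" "q \<noteq> 0"
    using that assms by (simp add: degree_mult_eq) linarith
  moreover have "coeff p m = 0 \<or> coeff q n = 0"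
    using False assms by (metis coeff_eq_0 le_neq_implies_less)
  ultimately show ?thesis
    by (cases "p = 0 \<or> q = 0") (auto simp: coeff_eq_0)
qed

text \<open>
  The value at infinity may be computed from any representation, because the coefficient of a
  product at the sum of two degree bounds is the product of the coefficients at those bounds;
  this allows one to compare top coefficients in \<open>p * q' = p' * q\<close>. The bound \<open>n\<close> may
  exceed the degree of \<open>p\<close>, which is the case of value \<open>0\<close>.
\<close>

lemma rat_eval_InftyI:
  assumes f: "f = to_fract p / to_fract q" and p: "degree p \<le> n" and q: "degree q \<le> n"
    and n: "coeff q n \<noteq> 0"
  shows "rat_eval f Infty = Pt (coeff p n / coeff q n)"
proof -
  obtain p' q' where red: "quot_of_fract f = (p', q')" "q' \<noteq> 0" "f = to_fract p' / to_fract q'"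
    using quot_of_fract_cases[of f] .
  have "q \<noteq> 0" using n by auto
  have [simp]: "degree q = n"
    using q n le_degree by (metis le_antisym)
  have eq: "p * q' = p' * q"
    by (rule cross_multiply[OF f red(3) \<open>q \<noteq> 0\<close> red(2)])
  have deg: "degree p' \<le> degree q'"
  proof (cases "p = 0")
    case False
    then have "degree p + degree q' = degree p' + n"
      using eq red(2) \<open>q \<noteq> 0\<close> by (metis \<open>degree q = n\<close> degree_mult_eq mult_eq_0_iff)
    with p show ?thesis by linarith
  qed (use eq \<open>q \<noteq> 0\<close> in auto)
  have "coeff p n * coeff q' (degree q') = coeff p' (degree q') * coeff q n"
    using coeff_mult_top[OF p, of q' "degree q'"] coeff_mult_top[OF deg q] eq
    by (simp add: add.commute)
  then show ?thesis
    using red(1,2) n deg by (simp add: frac_eq_eq)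
qed

section \<open>The substar conjugate\<close>

lemma poly_substar_0 [simp]: "poly_substar 0 = 0"
  by (simp add: poly_substar_def)

lemma poly_substar_pCons: "poly_substar (pCons a p) = ratC (cnj a) + inverse ratX * poly_substar p"
  by (simp add: poly_substar_def map_poly_pCons)

lemma poly_substar_1 [simp]: "poly_substar 1 = 1"
  unfolding one_pCons by (simp add: poly_substar_pCons)

lemma poly_substar_add: "poly_substar (p + q) = poly_substar p + poly_substar q"
proof (induction p arbitrary: q)
  case (pCons a p)
  then show ?case
    by (cases q) (simp add: poly_substar_pCons ratC_add algebra_simps)
qed simp

lemma poly_substar_smult: "poly_substar (smult c p) = ratC (cnj c) * poly_substar p"
  by (induction p) (simp_all add: poly_substar_pCons ratC_mult algebra_simps)

lemma poly_substar_mult: "poly_substar (p * q) = poly_substar p * poly_substar q"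
  by (induction p)
    (simp_all add: poly_substar_pCons poly_substar_add poly_substar_smult algebra_simps)

lemma has_value_poly_substar:
  assumes "z \<noteq> 0"
  shows "has_value (poly_substar p) z (cnj (poly p (1 / cnj z)))"
proof (induction p)
  case 0
  then show ?case using has_value_ratC[of 0 z] by simp
next
  case (pCons a p)
  have "has_value (poly_substar (pCons a p)) z (cnj a + inverse z * cnj (poly p (1 / cnj z)))"
    unfolding poly_substar_pCons
    by (intro has_value_add has_value_mult has_value_inverse has_value_ratX has_value_ratC
        pCons assms)
  then show ?case by (simp add: field_simps)
qed

text \<open>
  The values of \<open>poly_substar p\<close> determine those of \<open>p\<close> at every nonzero point, and a
  nonzero polynomial has only finitely many roots.
\<close>

lemma poly_substar_eq_0_iff [simp]: "poly_substar p = 0 \<longleftrightarrow> p = 0"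
proof
  assume 0: "poly_substar p = 0"
  have "poly p w = 0" if "w \<noteq> 0" for w
  proof -
    have "has_value (poly_substar p) (1 / cnj w) (cnj (poly p w))"
      using has_value_poly_substar[of "1 / cnj w" p] that by simp
    with 0 rat_fun_eqI[OF has_value_ratC[of 0 "1 / cnj w"]] show ?thesis
      by (auto dest: rat_fun_eqI)
  qed
  then have "- {0} \<subseteq> {w. poly p w = 0}" by auto
  moreover have "infinite (- {0 :: complex})"
    by (simp add: finite_compl infinite_UNIV_char_0)
  ultimately show "p = 0"
    by (metis poly_roots_finite rev_finite_subset)
qed simp

text \<open>
  The conjugate is defined through the reduced representation; by multiplicativity on
  polynomials any other representation yields the same result. All algebraic rules for
  \<open>substar\<close> follow from this.
\<close>

lemma substar_quotient:
  assumes "q \<noteq> 0"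
  shows "substar (to_fract p / to_fract q) = poly_substar p / poly_substar q"
proof -
  define f where "f = to_fract p / to_fract q"
  obtain p' q' where red: "quot_of_fract f = (p', q')" "q' \<noteq> 0" "f = to_fract p' / to_fract q'"
    using quot_of_fract_cases[of f] .
  have "p * q' = p' * q"
    by (rule cross_multiply[OF f_def red(3) assms red(2)])
  then have "poly_substar p * poly_substar q' = poly_substar p' * poly_substar q"
    by (metis poly_substar_mult)
  then show ?thesis
    using red(1,2) assms unfolding f_def[symmetric] substar_def by (simp add: frac_eq_eq)
qed

lemma substar_to_fract: "substar (to_fract p) = poly_substar p"
  using substar_quotient[of 1 p] by simp

lemma substar_mult: "substar (f * g) = substar f * substar g"
proof -
  obtain a b c d where *: "f = to_fract a / to_fract b" "b \<noteq> 0" "g = to_fract c / to_fract d" "d \<noteq> 0"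
    using quot_of_fract_cases by metis
  then have "f * g = to_fract (a * c) / to_fract (b * d)" by simp
  then have "substar (f * g) = poly_substar (a * c) / poly_substar (b * d)"
    using substar_quotient[of "b * d" "a * c"] * by simp
  then show ?thesis
    using * by (simp add: substar_quotient poly_substar_mult)
qed

lemma substar_add: "substar (f + g) = substar f + substar g"
proof -
  obtain a b c d where *: "f = to_fract a / to_fract b" "b \<noteq> 0" "g = to_fract c / to_fract d" "d \<noteq> 0"
    using quot_of_fract_cases by metis
  then have "f + g = to_fract (a * d + c * b) / to_fract (b * d)" by (simp add: add_frac_eq)
  then have "substar (f + g) = poly_substar (a * d + c * b) / poly_substar (b * d)"
    using substar_quotient[of "b * d" "a * d + c * b"] * by simp
  then show ?thesis
    using * by (simp add: substar_quotient poly_substar_mult poly_substar_add add_frac_eq)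
qed

lemma substar_ratC [simp]: "substar (ratC c) = ratC (cnj c)"
  by (simp add: ratC_def substar_to_fract poly_substar_pCons)

lemma substar_0 [simp]: "substar 0 = 0"
  and substar_1 [simp]: "substar 1 = 1"
  using substar_ratC[of 0] substar_ratC[of 1] by simp_all

lemma substar_ratX [simp]: "substar ratX = inverse ratX"
  by (simp add: ratX_def substar_to_fract poly_substar_pCons)

lemma substar_inverse: "substar (inverse f) = inverse (substar f)"
proof (cases "f = 0")
  case False
  then have "substar (inverse f) * substar f = 1"
    by (simp flip: substar_mult)
  then show ?thesis
    by (metis inverse_unique mult.commute)
qed simp

lemma substar_divide: "substar (f / g) = substar f / substar g"
  by (simp add: divide_inverse substar_mult substar_inverse)

lemma substar_uminus: "substar (- f) = - substar f"
  using substar_add[of f "- f"] by (simp add: add_eq_0_iff)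

lemma substar_diff: "substar (f - g) = substar f - substar g"
  using substar_add[of f "- g"] by (simp add: substar_uminus)

lemma substar_prod: "substar (\<Prod>i\<in>A. f i) = (\<Prod>i\<in>A. substar (f i))"
  by (induction A rule: infinite_finite_induct) (simp_all add: substar_mult)

lemma substar_substar [simp]: "substar (substar f) = f"
proof -
  have poly: "substar (poly_substar p) = to_fract p" for p
    by (induction p)
      (simp_all add: poly_substar_pCons substar_add substar_mult substar_inverse to_fract_pCons)
  obtain p q where "f = to_fract p / to_fract q" "q \<noteq> 0"
    using quot_of_fract_cases[of f] .
  then show ?thesis
    by (simp add: substar_divide substar_to_fract poly)
qed

lemma has_value_substar:
  assumes "has_value f (1 / cnj z) v" "z \<noteq> 0"
  shows "has_value (substar f) z (cnj v)"
proof -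
  obtain p q where *: "f = to_fract p / to_fract q" "poly q (1 / cnj z) \<noteq> 0"
      "v = poly p (1 / cnj z) / poly q (1 / cnj z)"
    using assms unfolding has_value_def by auto
  then have "q \<noteq> 0" by auto
  then show ?thesis
    using * assms(2)
      has_value_divide[OF has_value_poly_substar[of z p] has_value_poly_substar[of z q]]
    by (simp add: substar_quotient)
qed

text \<open>
  The reversed conjugate polynomial. Its top coefficient carries the value of \<open>p\<close> at
  \<open>0\<close>, which is what relates evaluation at \<open>0\<close> to evaluation at infinity.
\<close>

lemma poly_substar_clear_denominator:
  assumes "degree p \<le> n"
  obtains r where "ratX ^ n * poly_substar p = to_fract r" "degree r \<le> n"
    "coeff r n = cnj (coeff p 0)"
  using assms
proof (induction p arbitrary: n thesis)
  case 0
  then show ?case by (metis coeff_0 complex_cnj_zero degree_0 mult_zero_right poly_substar_0 to_fract_0 zero_le)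
next
  case (pCons a p)
  show ?case
  proof (cases "p = 0")
    case True
    then have "ratX ^ n * poly_substar (pCons a p) = to_fract (monom (cnj a) n)"
      by (simp add: poly_substar_pCons to_fract_monom)
    then show ?thesis
      using pCons.prems(1)[of "monom (cnj a) n"] by (simp add: degree_monom_le)
  next
    case False
    then obtain m where n: "n = Suc m" and m: "degree p \<le> m"
      using pCons.prems(2) by (metis Suc_le_D Suc_le_mono degree_pCons_eq)
    then obtain r where r: "ratX ^ m * poly_substar p = to_fract r" "degree r \<le> m"
      using pCons.IH by blast
    have "ratX ^ n * poly_substar (pCons a p) = to_fract (monom (cnj a) n) + ratX ^ m * poly_substar p"
      unfolding to_fract_monom by (simp add: poly_substar_pCons n distrib_left)
    then have "ratX ^ n * poly_substar (pCons a p) = to_fract (monom (cnj a) n + r)"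
      by (simp add: r(1))
    moreover have "degree (monom (cnj a) n + r) \<le> n"
      using r(2) n by (intro degree_add_le) (auto simp: degree_monom_le)
    moreover have "coeff (monom (cnj a) n + r) n = cnj (coeff (pCons a p) 0)"
      using r(2) n by (simp add: coeff_eq_0)
    ultimately show ?thesis by (rule pCons.prems(1))
  qed
qed

text \<open>
  For \<open>a = 0\<close> the reflected point is infinity; clearing denominators by a common power of
  \<open>z\<close> presents the conjugate as a quotient of reversed polynomials.
\<close>

lemma rat_eval_substar:
  assumes "rat_eval f (Pt a) = Pt v"
  shows "rat_eval (substar f) (reflect_pt a) = Pt (cnj v)"
proof (cases "a = 0")
  case False
  then show ?thesis
    using assms has_value_substar[of f "1 / cnj a" v]
    by (simp add: reflect_pt_def rat_eval_Pt_iff del: rat_eval.simps)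
next
  case True
  then obtain p q where f: "f = to_fract p / to_fract q" "poly q 0 \<noteq> 0" "v = poly p 0 / poly q 0"
    using assms unfolding rat_eval_Pt_iff has_value_def by auto
  define n where "n = max (degree p) (degree q)"
  obtain r where r: "ratX ^ n * poly_substar p = to_fract r" "degree r \<le> n" "coeff r n = cnj (coeff p 0)"
    using poly_substar_clear_denominator[of p n] by (auto simp: n_def)
  obtain s where s: "ratX ^ n * poly_substar q = to_fract s" "degree s \<le> n" "coeff s n = cnj (coeff q 0)"
    using poly_substar_clear_denominator[of q n] by (auto simp: n_def)
  have "q \<noteq> 0" using f(2) by auto
  then have "substar f = to_fract r / to_fract s"
    unfolding f(1) by (simp add: substar_quotient flip: r(1) s(1))
  then have "rat_eval (substar f) Infty = Pt (coeff r n / coeff s n)"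
    by (rule rat_eval_InftyI) (use r s f in \<open>auto simp: poly_0_coeff_0\<close>)
  with True f r s show ?thesis
    by (simp add: reflect_pt_def poly_0_coeff_0)
qed

lemma rat_eval_ratC_mult:
  assumes "rat_eval f w = Pt v"
  shows "rat_eval (ratC c * f) w = Pt (c * v)"
proof (cases w)
  case (Pt z)
  with assms show ?thesis
    by (metis rat_eval_Pt_iff has_value_mult has_value_ratC)
next
  case Infty
  obtain p q where red: "quot_of_fract f = (p, q)" "q \<noteq> 0" "f = to_fract p / to_fract q"
    using quot_of_fract_cases[of f] .
  have *: "degree p \<le> degree q" "v = coeff p (degree q) / lead_coeff q"
    using assms Infty red by (auto split: if_splits)
  have "ratC c * f = to_fract (smult c p) / to_fract q"
    using red(3) by (simp add: to_fract_smult)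
  then have "rat_eval (ratC c * f) Infty = Pt (coeff (smult c p) (degree q) / coeff q (degree q))"
    by (rule rat_eval_InftyI) (use * red in \<open>auto intro: degree_smult_le[THEN order_trans]\<close>)
  with * Infty show ?thesis by simp
qed

text \<open>
  This turns a normalization \<open>> 0\<close> into uniqueness: two functions that differ by a
  unimodular constant and are both positive at one point are equal.
\<close>

lemma positive_at_scaleD:
  assumes "positive_at f w" "positive_at (ratC c * f) w" "cmod c = 1"
  shows "c = 1"
proof -
  obtain r s where rs: "r > 0" "s > 0" "rat_eval f w = Pt (of_real r)"
      "rat_eval (ratC c * f) w = Pt (of_real s)"
    using assms unfolding positive_at_def by auto
  then have "c * of_real r = of_real s"
    using rat_eval_ratC_mult[OF rs(3), of c] by simp
  then have "c = of_real (s / r)"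
    using rs by (simp add: field_simps)
  with assms(3) rs show ?thesis
    by (simp add: norm_divide)
qed

lemma positive_at_substar: "positive_at f (Pt a) \<Longrightarrow> positive_at (substar f) (reflect_pt a)"
  unfolding positive_at_def using rat_eval_substar complex_cnj_complex_of_real by metis

section \<open>Rational functions on the unit circle\<close>

definition circle_regular :: "ratfun \<Rightarrow> bool" where
  "circle_regular f \<longleftrightarrow> (\<forall>z. cmod z = 1 \<longrightarrow> (\<exists>v. has_value f z v))"

lemma circle_regular_has_value:
  "circle_regular f \<Longrightarrow> cmod z = 1 \<Longrightarrow> has_value f z (rat_fun f z)"
  unfolding circle_regular_def using rat_fun_eqI by blast

lemma circle_regular_ratC [simp]: "circle_regular (ratC c)"
  unfolding circle_regular_def using has_value_ratC by blast

lemma circle_regular_1 [simp]: "circle_regular 1"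
  using circle_regular_ratC[of 1] by simp

lemma circle_regular_add: "circle_regular f \<Longrightarrow> circle_regular g \<Longrightarrow> circle_regular (f + g)"
  unfolding circle_regular_def using has_value_add by blast

lemma circle_regular_mult: "circle_regular f \<Longrightarrow> circle_regular g \<Longrightarrow> circle_regular (f * g)"
  unfolding circle_regular_def using has_value_mult by blast

text \<open>
  Reflection in the circle fixes its points, so there the substar conjugate is the ordinary
  complex conjugate of the values.
\<close>

lemma has_value_substar_circle:
  assumes "circle_regular f" "cmod z = 1"
  shows "has_value (substar f) z (cnj (rat_fun f z))"
proof -
  have "z * cnj z = 1"
    using assms(2) complex_norm_square[of z] by simp
  moreover have "z \<noteq> 0"
    using assms(2) by auto
  ultimately have "1 / cnj z = z"
    by (simp add: divide_eq_eq)
  then show ?thesis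
    using has_value_substar[of f z] circle_regular_has_value[OF assms] \<open>1 / cnj z = z\<close> \<open>z \<noteq> 0\<close>
    by metis
qed

lemma circle_regular_substar: "circle_regular f \<Longrightarrow> circle_regular (substar f)"
  unfolding circle_regular_def[of "substar f"] using has_value_substar_circle by blast

lemma rat_fun_substar_circle:
  "circle_regular f \<Longrightarrow> cmod z = 1 \<Longrightarrow> rat_fun (substar f) z = cnj (rat_fun f z)"
  using has_value_substar_circle rat_fun_eqI by blast

text \<open>
  Functions with values of modulus one on the circle: multiplication by them is isometric.
\<close>

definition circle_unimodular :: "ratfun \<Rightarrow> bool" where
  "circle_unimodular f \<longleftrightarrow> (\<forall>z. cmod z = 1 \<longrightarrow> (\<exists>v. has_value f z v \<and> cmod v = 1))"

lemma circle_unimodular_regular: "circle_unimodular f \<Longrightarrow> circle_regular f"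
  unfolding circle_regular_def circle_unimodular_def by blast

lemma circle_unimodular_norm: "circle_unimodular f \<Longrightarrow> cmod z = 1 \<Longrightarrow> cmod (rat_fun f z) = 1"
  unfolding circle_unimodular_def using rat_fun_eqI by blast

lemma circle_unimodular_1 [simp]: "circle_unimodular 1"
  unfolding circle_unimodular_def using has_value_ratC[of 1] by (auto intro!: exI[of _ 1])

lemma circle_unimodular_mult:
  assumes "circle_unimodular f" "circle_unimodular g"
  shows "circle_unimodular (f * g)"
  unfolding circle_unimodular_def
proof (intro allI impI)
  fix z :: complex
  assume "cmod z = 1"
  then obtain u v where "has_value f z u" "cmod u = 1" "has_value g z v" "cmod v = 1"
    using assms unfolding circle_unimodular_def by blast
  then show "\<exists>w. has_value (f * g) z w \<and> cmod w = 1"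
    by (intro exI[of _ "u * v"]) (simp add: has_value_mult norm_mult)
qed

lemma circle_unimodular_inverse:
  assumes "circle_unimodular f"
  shows "circle_unimodular (inverse f)"
  unfolding circle_unimodular_def
proof (intro allI impI)
  fix z :: complex
  assume "cmod z = 1"
  then obtain v where v: "has_value f z v" "cmod v = 1"
    using assms unfolding circle_unimodular_def by blast
  then have "v \<noteq> 0" by auto
  with v show "\<exists>w. has_value (inverse f) z w \<and> cmod w = 1"
    by (intro exI[of _ "inverse v"]) (simp add: has_value_inverse norm_inverse)
qed

lemma circle_unimodular_prod:
  "(\<And>i. i \<in> A \<Longrightarrow> circle_unimodular (f i)) \<Longrightarrow> circle_unimodular (\<Prod>i\<in>A. f i)"
  by (induction A rule: infinite_finite_induct) (simp_all add: circle_unimodular_mult)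

section \<open>The inner product\<close>

locale circle_prob = prob_space \<mu> for \<mu> :: "complex measure" +
  assumes sets_circle: "sets \<mu> = sets circle_borel"
begin

lemma space_circle: "space \<mu> = sphere 0 1"
  using sets_eq_imp_space_eq[OF sets_circle] by (simp add: circle_borel_def space_restrict_space)

lemma norm_on_circle: "z \<in> space \<mu> \<Longrightarrow> cmod z = 1"
  by (simp add: space_circle)

text \<open>
  A rational function without poles on the circle is continuous on this compact set, hence
  bounded.
\<close>

lemma integrable_rat_fun:
  assumes "circle_regular f"
  shows "integrable \<mu> (rat_fun f)"
proof -
  obtain p q where pq: "quot_of_fract f = (p, q)"
    by fastforce
  have eq: "rat_fun f = (\<lambda>z. poly p z / poly q z)"
    using pq by (simp add: rat_fun_def fun_eq_iff)
  have nz: "poly q z \<noteq> 0" if "z \<in> sphere 0 1" for z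
    using has_value_quot_of_fract(1)[OF circle_regular_has_value[OF assms] pq] that by simp
  have "rat_fun f \<in> borel_measurable borel"
    unfolding eq by (intro borel_measurable_divide borel_measurable_continuous_onI continuous_intros)
  then have "rat_fun f \<in> borel_measurable circle_borel"
    unfolding circle_borel_def by (rule measurable_restrict_space1)
  then have meas: "rat_fun f \<in> borel_measurable \<mu>"
    using sets_circle by (simp cong: measurable_cong_sets)
  have "continuous_on (sphere 0 1) (rat_fun f)"
    unfolding eq using nz by (intro continuous_intros) auto
  then have "bounded (rat_fun f ` sphere 0 1)"
    by (intro compact_imp_bounded compact_continuous_image) auto
  then obtain b where "\<forall>z\<in>sphere 0 1. norm (rat_fun f z) \<le> b"
    unfolding bounded_iff by auto
  then show ?thesis
    using meas by (intro integrable_const_bound[where B = b] AE_I2) (simp_all add: space_circle)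
qed

text \<open>
  On the circle the integrand of the inner product is again a rational function, so
  linearity and integrability reduce to statements about single rational functions.
\<close>

lemma rat_inner_eq_integral:
  assumes "circle_regular f" "circle_regular g"
  shows "rat_inner \<mu> f g = (\<integral>z. rat_fun (substar f * g) z \<partial>\<mu>)"
  unfolding rat_inner_def
proof (rule Bochner_Integration.integral_cong[OF refl])
  fix z
  assume "z \<in> space \<mu>"
  then have "cmod z = 1" by (rule norm_on_circle)
  then show "cnj (rat_fun f z) * rat_fun g z = rat_fun (substar f * g) z"
    using assms
    by (metis rat_fun_eqI has_value_mult has_value_substar_circle circle_regular_has_value)
qed

lemma rat_inner_add_right:
  assumes f: "circle_regular f" and g: "circle_regular g" and h: "circle_regular h"
  shows "rat_inner \<mu> f (g + h) = rat_inner \<mu> f g + rat_inner \<mu> f h"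
proof -
  have reg: "circle_regular (substar f * g)" "circle_regular (substar f * h)"
    using assms by (auto intro: circle_regular_mult circle_regular_substar)
  have "rat_inner \<mu> f (g + h) = (\<integral>z. rat_fun (substar f * g + substar f * h) z \<partial>\<mu>)"
    using assms by (simp add: rat_inner_eq_integral circle_regular_add distrib_left)
  also have "\<dots> = (\<integral>z. rat_fun (substar f * g) z + rat_fun (substar f * h) z \<partial>\<mu>)"
    using reg
    by (intro Bochner_Integration.integral_cong refl rat_fun_eqI has_value_add
        circle_regular_has_value norm_on_circle)
  also have "\<dots> = rat_inner \<mu> f g + rat_inner \<mu> f h"
    using assms reg by (simp add: rat_inner_eq_integral integrable_rat_fun)
  finally show ?thesis .
qed

lemma rat_inner_scale_right:
  assumes "circle_regular g"
  shows "rat_inner \<mu> f (ratC c * g) = c * rat_inner \<mu> f g"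
proof -
  have "rat_inner \<mu> f (ratC c * g) = (\<integral>z. c * (cnj (rat_fun f z) * rat_fun g z) \<partial>\<mu>)"
    unfolding rat_inner_def
  proof (rule Bochner_Integration.integral_cong[OF refl])
    fix z
    assume "z \<in> space \<mu>"
    then have "rat_fun (ratC c * g) z = c * rat_fun g z"
      using assms
      by (intro rat_fun_eqI has_value_mult has_value_ratC circle_regular_has_value norm_on_circle)
    then show "cnj (rat_fun f z) * rat_fun (ratC c * g) z = c * (cnj (rat_fun f z) * rat_fun g z)"
      by simp
  qed
  then show ?thesis by (simp add: rat_inner_def)
qed

lemma rat_inner_commute: "rat_inner \<mu> g f = cnj (rat_inner \<mu> f g)"
  unfolding rat_inner_def by (subst Bochner_Integration.integral_cnj[symmetric]) (simp add: mult.commute)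

lemma rat_inner_diff_left:
  assumes f: "circle_regular f" and g: "circle_regular g" and h: "circle_regular h"
  shows "rat_inner \<mu> (f - ratC c * g) h = rat_inner \<mu> f h - cnj c * rat_inner \<mu> g h"
proof -
  have "rat_inner \<mu> h (f + ratC (- c) * g) = rat_inner \<mu> h f + (- c) * rat_inner \<mu> h g"
    using assms
    by (simp only: rat_inner_add_right rat_inner_scale_right circle_regular_mult circle_regular_ratC)
  then show ?thesis
    by (subst (1 2 3) rat_inner_commute) (simp add: ratC_uminus)
qed

lemma rat_inner_unimodular_mult:
  assumes u: "circle_unimodular u" and f: "circle_regular f" and g: "circle_regular g"
  shows "rat_inner \<mu> (u * f) (u * g) = rat_inner \<mu> f g"
  unfolding rat_inner_def
proof (rule Bochner_Integration.integral_cong[OF refl])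
  fix z
  assume "z \<in> space \<mu>"
  then have z: "cmod z = 1" by (rule norm_on_circle)
  have prod: "rat_fun (u * h) z = rat_fun u z * rat_fun h z" if "circle_regular h" for h
    using that z u circle_unimodular_regular
    by (intro rat_fun_eqI has_value_mult circle_regular_has_value) auto
  have "cnj (rat_fun u z) * rat_fun u z = 1"
    using circle_unimodular_norm[OF u z]
    by (metis complex_norm_square mult.commute of_real_1 one_power2)
  moreover have "cnj (rat_fun (u * f) z) * rat_fun (u * g) z
      = (cnj (rat_fun u z) * rat_fun u z) * (cnj (rat_fun f z) * rat_fun g z)"
    unfolding prod[OF f] prod[OF g] by (simp add: mult_ac)
  ultimately show "cnj (rat_fun (u * f) z) * rat_fun (u * g) z = cnj (rat_fun f z) * rat_fun g z"
    by simp
qed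

lemma rat_inner_substar:
  assumes f: "circle_regular f" and g: "circle_regular g"
  shows "rat_inner \<mu> (substar f) (substar g) = cnj (rat_inner \<mu> f g)"
proof -
  have "rat_inner \<mu> (substar f) (substar g) = (\<integral>z. cnj (cnj (rat_fun f z) * rat_fun g z) \<partial>\<mu>)"
    unfolding rat_inner_def
    using rat_fun_substar_circle[OF f norm_on_circle] rat_fun_substar_circle[OF g norm_on_circle]
    by (intro Bochner_Integration.integral_cong refl) simp
  then show ?thesis
    unfolding rat_inner_def by (simp only: Bochner_Integration.integral_cnj)
qed

end

section \<open>Nested spaces and orthonormal systems\<close>

lemma rat_space_mono: "m \<le> n \<Longrightarrow> rat_space B m \<subseteq> rat_space B n"
  unfolding rat_space_def by (intro ratfun.span_mono image_mono) auto

lemma rat_space_scale: "f \<in> rat_space B n \<Longrightarrow> ratC c * f \<in> rat_space B n"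
  unfolding rat_space_def using ratfun.span_scale[of f _ c] by (simp add: ratscale_def)

lemma rat_space_diff: "f \<in> rat_space B n \<Longrightarrow> g \<in> rat_space B n \<Longrightarrow> f - g \<in> rat_space B n"
  unfolding rat_space_def by (rule ratfun.span_diff)

lemma rat_space_Suc_cases:
  assumes "f \<in> rat_space B (Suc n)"
  obtains c where "f - ratC c * B (Suc n) \<in> rat_space B n"
proof -
  have "B ` {0..Suc n} = insert (B (Suc n)) (B ` {0..n})"
    by (simp add: atLeast0_atMost_Suc)
  with assms show thesis
    using that by (auto simp: rat_space_def ratfun.span_insert ratscale_def)
qed

lemma rat_space_induct [consumes 1, case_names gen zero add scale]:
  assumes "f \<in> rat_space B n"
    and "\<And>k. k \<le> n \<Longrightarrow> P (B k)"
    and "P 0"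
    and "\<And>f g. P f \<Longrightarrow> P g \<Longrightarrow> P (f + g)"
    and "\<And>c f. P f \<Longrightarrow> P (ratC c * f)"
  shows "P f"
proof -
  have "ratfun.subspace {f. P f}"
    using assms(3-5) by (auto simp: ratfun.subspace_def ratscale_def)
  moreover have "B ` {0..n} \<subseteq> {f. P f}"
    using assms(2) by auto
  ultimately have "rat_space B n \<subseteq> {f. P f}"
    unfolding rat_space_def by (rule ratfun.span_minimal[rotated])
  with assms(1) show ?thesis by auto
qed

lemma circle_regular_rat_space:
  assumes "f \<in> rat_space B n" "\<And>k. circle_regular (B k)"
  shows "circle_regular f"
  using assms(1)
proof (induction rule: rat_space_induct)
  case zero
  show ?case using circle_regular_ratC[of 0] by simp
qed (simp_all add: assms(2) circle_regular_add circle_regular_mult)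

lemma substar_rat_space:
  assumes "f \<in> rat_space B n" "\<And>k. substar (B k) = C k"
  shows "substar f \<in> rat_space C n"
  using assms(1)
proof (induction rule: rat_space_induct)
  case (gen k)
  then show ?case by (simp add: assms(2) rat_space_def ratfun.span_base)
next
  case zero
  show ?case by (simp add: rat_space_def ratfun.span_zero)
next
  case (add f g)
  then show ?case by (simp add: substar_add rat_space_def ratfun.span_add)
next
  case (scale c f)
  then show ?case by (simp add: substar_mult rat_space_scale)
qed

text \<open>
  A dimension count. The right-hand side is spanned by the \<open>n + 1\<close> functions
  \<open>z\<^sup>i u\<close>, and it contains \<open>B\<^sub>0, \<dots>, B\<^sub>n\<close>. These are linearly independent, since no
  generator lies in the span of the earlier ones, so they span the right-hand side.
\<close>

lemma rat_space_eq_polynomial_multiples: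
  assumes gen: "\<And>k. k \<le> n \<Longrightarrow> \<exists>p. degree p \<le> n \<and> B k = to_fract p * u"
    and B0: "B 0 \<noteq> 0"
    and new: "\<And>k. k < n \<Longrightarrow> B (Suc k) \<notin> rat_space B k"
  shows "rat_space B n = {to_fract p * u | p. degree p \<le> n}" (is "_ = ?P")
proof
  have sub: "ratfun.subspace ?P"
    unfolding ratfun.subspace_def
  proof (intro conjI ballI allI)
    show "0 \<in> ?P" by (force intro!: exI[of _ 0])
    show "f + g \<in> ?P" if "f \<in> ?P" "g \<in> ?P" for f g
    proof -
      obtain p q where "f = to_fract p * u" "degree p \<le> n" "g = to_fract q * u" "degree q \<le> n"
        using \<open>f \<in> ?P\<close> \<open>g \<in> ?P\<close> by blast
      then have "f + g = to_fract (p + q) * u \<and> degree (p + q) \<le> n"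
        by (simp add: distrib_right degree_add_le)
      then show ?thesis by blast
    qed
    show "ratscale c f \<in> ?P" if "f \<in> ?P" for c f
    proof -
      obtain p where "f = to_fract p * u" "degree p \<le> n"
        using \<open>f \<in> ?P\<close> by blast
      then have "ratscale c f = to_fract (smult c p) * u \<and> degree (smult c p) \<le> n"
        by (simp add: ratscale_def to_fract_smult mult.assoc order_trans[OF degree_smult_le])
      then show ?thesis by blast
    qed
  qed
  have "B ` {0..n} \<subseteq> ?P"
    using gen by fastforce
  then show "rat_space B n \<subseteq> ?P"
    unfolding rat_space_def using sub by (rule ratfun.span_minimal)
  have indep: "ratfun.independent (B ` {0..k}) \<and> card (B ` {0..k}) = Suc k" if "k \<le> n" for k
    using that
  proof (induction k)
    case 0
    then show ?case using B0 by (simp add: ratfun.dependent_single)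
  next
    case (Suc k)
    have "B (Suc k) \<notin> ratfun.span (B ` {0..k})"
      using new[of k] Suc.prems by (simp add: rat_space_def)
    moreover from this have "B (Suc k) \<notin> B ` {0..k}"
      using ratfun.span_base[of "B (Suc k)" "B ` {0..k}"] by argo
    moreover have "B ` {0..Suc k} = insert (B (Suc k)) (B ` {0..k})"
      by (simp add: atLeast0_atMost_Suc)
    ultimately show ?case
      using Suc by (simp add: ratfun.independent_insertI)
  qed
  \<comment> \<open>The monomial multiples of \<open>u\<close>, an upper bound for the dimension.\<close>
  define G where "G = (\<lambda>i. ratX ^ i * u) ` {0..n}"
  have P_span: "?P \<subseteq> ratfun.span G"
  proof clarify
    fix p :: "complex poly"
    assume "degree p \<le> n"
    have "to_fract p = (\<Sum>i\<le>n. ratC (coeff p i) * ratX ^ i)"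
      by (subst poly_as_sum_of_monoms'[OF \<open>degree p \<le> n\<close>, symmetric]) (simp add: to_fract_monom)
    then have "to_fract p * u = (\<Sum>i\<le>n. ratscale (coeff p i) (ratX ^ i * u))"
      by (simp add: ratscale_def sum_distrib_right mult.assoc)
    also have "\<dots> \<in> ratfun.span G"
      unfolding G_def by (intro ratfun.span_sum ratfun.span_scale ratfun.span_base) auto
    finally show "to_fract p * u \<in> ratfun.span G" .
  qed
  show "?P \<subseteq> rat_space B n"
  proof
    fix f
    assume f: "f \<in> ?P"
    show "f \<in> rat_space B n"
    proof (rule ccontr)
      assume nin: "f \<notin> rat_space B n"
      then have "f \<notin> B ` {0..n}"
        using ratfun.span_base[of f "B ` {0..n}"] by (auto simp only: rat_space_def)
      then have card: "card (insert f (B ` {0..n})) = Suc (Suc n)"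
        using indep[of n] by simp
      have "ratfun.independent (insert f (B ` {0..n}))"
        using nin indep[of n] by (simp add: rat_space_def ratfun.independent_insertI)
      moreover have "insert f (B ` {0..n}) \<subseteq> ratfun.span G"
        using P_span f \<open>B ` {0..n} \<subseteq> ?P\<close> by blast
      ultimately have "card (insert f (B ` {0..n})) \<le> card G"
        using ratfun.independent_span_bound[of G] by (simp add: G_def)
      also have "card G \<le> Suc n"
        unfolding G_def using card_image_le[of "{0..n}"] by fastforce
      finally show False using card by simp
    qed
  qed
qed

text \<open>
  If \<open>B\<^sub>k\<^sub>+\<^sub>1\<close> were in the span of the earlier generators, the two consecutive spaces would
  coincide and leave no room for the next orthonormal function.
\<close>

lemma orthonormal_rational_new_generator:
  assumes "orthonormal_rational \<mu> B \<phi>"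
  shows "B (Suc k) \<notin> rat_space B k"
proof
  assume in_span: "B (Suc k) \<in> rat_space B k"
  have "\<phi> (Suc k) \<in> rat_space B (Suc k) - rat_space B k"
    using assms unfolding orthonormal_rational_def by (metis diff_Suc_1 le_add1 plus_1_eq_Suc)
  moreover obtain c where "\<phi> (Suc k) - ratC c * B (Suc k) \<in> rat_space B k"
    using calculation rat_space_Suc_cases by blast
  then have "\<phi> (Suc k) \<in> rat_space B k"
    using rat_space_scale[OF in_span, of c] unfolding rat_space_def
    by (metis diff_add_cancel ratfun.span_add)
  ultimately show False by blast
qed

locale orthonormal_rational_functions = circle_prob +
  fixes B \<phi> :: "nat \<Rightarrow> ratfun"
  assumes orthonormal: "orthonormal_rational \<mu> B \<phi>"
    and regular: "\<And>k. circle_regular (B k)"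
    and B_0: "B 0 = 1"
begin

lemma phi_0: "\<phi> 0 = 1"
  and phi_Suc_in: "\<phi> (Suc n) \<in> rat_space B (Suc n)"
  and phi_Suc_notin: "\<phi> (Suc n) \<notin> rat_space B n"
  and phi_Suc_orthogonal: "g \<in> rat_space B n \<Longrightarrow> rat_inner \<mu> (\<phi> (Suc n)) g = 0"
  and phi_normed: "rat_inner \<mu> (\<phi> n) (\<phi> n) = 1"
  using orthonormal unfolding orthonormal_rational_def
  by (auto dest: spec[of _ "Suc n"])

lemma regular_space: "f \<in> rat_space B n \<Longrightarrow> circle_regular f"
  using circle_regular_rat_space regular by blast

text \<open>
  Passing from the generator \<open>B\<close> to \<open>\<phi>\<close> in the decomposition is possible because
  \<open>\<phi>\<close> itself has a nonzero component along the generator.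
\<close>

lemma rat_space_Suc_orthonormal_cases:
  assumes "f \<in> rat_space B (Suc n)"
  obtains c where "f - ratC c * \<phi> (Suc n) \<in> rat_space B n"
proof -
  obtain a where a: "f - ratC a * B (Suc n) \<in> rat_space B n"
    using rat_space_Suc_cases assms by blast
  obtain b where b: "\<phi> (Suc n) - ratC b * B (Suc n) \<in> rat_space B n"
    using rat_space_Suc_cases phi_Suc_in by blast
  have "b \<noteq> 0"
    using b phi_Suc_notin by auto
  have "ratC a = ratC (a / b) * ratC b"
    using \<open>b \<noteq> 0\<close> by (simp flip: ratC_mult)
  then have "f - ratC (a / b) * \<phi> (Suc n)
      = (f - ratC a * B (Suc n)) - ratC (a / b) * (\<phi> (Suc n) - ratC b * B (Suc n))"
    by (simp add: algebra_simps)
  then show thesis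
    using that rat_space_diff[OF a rat_space_scale[OF b]] by metis
qed

text \<open>
  The norms \<open>1\<close> of the system make the inner product nondegenerate on each space: by
  induction, testing \<open>f\<close> against the last \<open>\<phi>\<close> shows that \<open>f\<close> has no component along it and
  hence lies in the preceding space.
\<close>

lemma orthogonal_to_own_space:
  assumes "f \<in> rat_space B n" "\<And>g. g \<in> rat_space B n \<Longrightarrow> rat_inner \<mu> f g = 0"
  shows "f = 0"
  using assms
proof (induction n arbitrary: f)
  case 0
  then obtain c where c: "f = ratC c"
    by (auto simp: rat_space_def B_0 ratfun.span_singleton ratscale_def)
  have "1 \<in> rat_space B 0"
    unfolding rat_space_def using B_0 by (simp add: ratfun.span_base)
  then have "rat_inner \<mu> 1 f = 0"
    using 0(2)[of 1] rat_inner_commute[of 1 f] by simp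
  moreover have "rat_inner \<mu> 1 f = c * rat_inner \<mu> 1 1"
    using rat_inner_scale_right[of 1 1 c] c by simp
  ultimately show ?case
    using phi_normed[of 0] c by (simp add: phi_0)
next
  case (Suc n)
  obtain c where h: "f - ratC c * \<phi> (Suc n) \<in> rat_space B n"
    using rat_space_Suc_orthonormal_cases Suc.prems(1) by blast
  have reg: "circle_regular f" "circle_regular (\<phi> (Suc n))"
    using Suc.prems(1) phi_Suc_in regular_space by blast+
  have "rat_inner \<mu> (f - ratC c * \<phi> (Suc n)) (\<phi> (Suc n)) = 0"
    using phi_Suc_orthogonal[OF h] by (subst rat_inner_commute) simp
  then have "c = 0"
    using Suc.prems(2)[OF phi_Suc_in] phi_normed[of "Suc n"] reg by (simp add: rat_inner_diff_left)
  then have "f \<in> rat_space B n"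
    using h by simp
  then show ?case
    using Suc.IH Suc.prems(2) rat_space_mono[of n "Suc n" B] by auto
qed

text \<open>
  Subtracting the right multiple of \<open>\<phi>\<close> leaves an element of the preceding space which is
  orthogonal to that space, hence zero.
\<close>

lemma unique_up_to_phase:
  assumes f: "f \<in> rat_space B (Suc n)"
    and orth: "\<And>g. g \<in> rat_space B n \<Longrightarrow> rat_inner \<mu> f g = 0"
    and normed: "rat_inner \<mu> f f = 1"
  obtains c where "cmod c = 1" "f = ratC c * \<phi> (Suc n)"
proof -
  obtain c where h: "f - ratC c * \<phi> (Suc n) \<in> rat_space B n"
    using rat_space_Suc_orthonormal_cases f by blast
  have reg: "circle_regular f" "circle_regular (\<phi> (Suc n))"
    using f phi_Suc_in regular_space by blast+
  have "rat_inner \<mu> (f - ratC c * \<phi> (Suc n)) g = 0" if "g \<in> rat_space B n" for g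
    using reg that regular_space[OF that]
    by (simp add: rat_inner_diff_left orth phi_Suc_orthogonal)
  then have eq: "f = ratC c * \<phi> (Suc n)"
    using orthogonal_to_own_space[OF h] by simp
  have "rat_inner \<mu> f f = c * rat_inner \<mu> f (\<phi> (Suc n))"
    using rat_inner_scale_right[OF reg(2), of f c] eq by simp
  also have "rat_inner \<mu> f (\<phi> (Suc n)) = cnj (rat_inner \<mu> (\<phi> (Suc n)) f)"
    by (rule rat_inner_commute)
  also have "rat_inner \<mu> (\<phi> (Suc n)) f = c"
    using rat_inner_scale_right[OF reg(2), of "\<phi> (Suc n)" c] eq phi_normed by simp
  finally have "(cmod c)\<^sup>2 = 1"
    using normed by (metis complex_norm_square of_real_eq_1_iff)
  then have "cmod c = 1"
    by (simp add: power2_eq_1_iff) (metis norm_ge_zero neg_0_le_iff_le not_one_le_zero)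
  with eq that show thesis by blast
qed

end

section \<open>Blaschke factors and the spaces they span\<close>

lemma blaschke_dot_0: "blaschke_dot \<alpha> \<gamma> \<nu> 0 = 1"
proof -
  have "{j\<in>{1..0}. \<gamma> j = \<nu> j} = {}" by auto
  then show ?thesis unfolding blaschke_dot_def by (simp only: prod.empty)
qed

lemma blaschke_dot_self: "blaschke_dot \<alpha> \<nu> \<nu> n = blaschke \<alpha> \<nu> n"
proof -
  have "{j\<in>{1..n}. \<nu> j = \<nu> j} = {1..n}" by auto
  then show ?thesis unfolding blaschke_dot_def blaschke_def by (simp only:)
qed

lemma sigma_unit: "cnj (sigma a) * sigma a = 1"
  by (simp add: sigma_def complex_norm_square[symmetric] power2_eq_square)

lemma sigma_nonzero: "sigma a \<noteq> 0"
  by (simp add: sigma_def)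

lemma linear_numerator_eq: "ratX - ratC a = to_fract [:-a, 1:]"
  by (simp add: to_fract_pCons ratC_uminus)

lemma linear_denominator_eq: "1 - ratC (cnj a) * ratX = to_fract [:1, - cnj a:]"
  by (simp add: to_fract_pCons ratC_uminus mult.commute)

lemma zeta_factors_nonzero: "ratX - ratC a \<noteq> 0" "1 - ratC (cnj a) * ratX \<noteq> 0"
  by (simp_all add: linear_numerator_eq linear_denominator_eq)

locale blaschke_points =
  fixes \<alpha> :: "nat \<Rightarrow> complex"
  assumes in_disk: "cmod (\<alpha> j) < 1"
begin

abbreviation z\<alpha> :: "nat \<Rightarrow> ratfun" where
  "z\<alpha> \<equiv> zeta \<alpha> (alpha_pt \<alpha>)"

lemma zeta_alpha_eq:
  "z\<alpha> j = ratC (sigma (\<alpha> j)) * (ratX - ratC (\<alpha> j)) / (1 - ratC (cnj (\<alpha> j)) * ratX)"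
  by (simp add: zeta_def alpha_pt_def)

lemma zeta_alpha_nonzero: "z\<alpha> j \<noteq> 0"
  unfolding zeta_alpha_eq
  using zeta_factors_nonzero[of "\<alpha> j"] sigma_nonzero by (simp del: right_minus_eq)

lemma alpha_neq_beta: "alpha_pt \<alpha> j \<noteq> beta_pt \<alpha> j"
proof
  assume "alpha_pt \<alpha> j = beta_pt \<alpha> j"
  then have "\<alpha> j \<noteq> 0" "\<alpha> j * cnj (\<alpha> j) = 1"
    by (auto simp: alpha_pt_def beta_pt_def reflect_pt_def field_simps split: if_splits)
  then have "(cmod (\<alpha> j))\<^sup>2 = 1"
    by (metis complex_norm_square of_real_eq_1_iff)
  then show False
    using in_disk[of j] by (simp add: abs_square_eq_1)
qed

text \<open>
  The reflected point has the reciprocal Blaschke factor. This holds exactly and not only up to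
  a constant because \<open>\<sigma>\<^sup>2 a = cnj a\<close>, with the same \<open>\<sigma>\<close> used in both factors.
\<close>

lemma zeta_beta_eq: "zeta \<alpha> (beta_pt \<alpha>) j = inverse (z\<alpha> j)"
proof (cases "\<alpha> j = 0")
  case True
  then show ?thesis
    by (simp add: zeta_def alpha_pt_def beta_pt_def reflect_pt_def sigma_def inverse_eq_divide)
next
  case False
  define a s where "a = \<alpha> j" and "s = sigma (\<alpha> j)"
  have a: "a \<noteq> 0" using False by (simp add: a_def)
  have ss: "s * s * a = cnj a"
  proof -
    have "s * s * a = cnj a * (a * cnj a) / (of_real (cmod a))\<^sup>2"
      using a by (simp add: s_def a_def sigma_def power2_eq_square)
    moreover have "(complex_of_real (cmod a))\<^sup>2 = a * cnj a"
      by (metis complex_norm_square of_real_power)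
    ultimately show ?thesis
      using a by simp
  qed
  \<comment> \<open>The product of the two numerators is the product of the two denominators.\<close>
  have "ratC s * (ratX - ratC (1 / cnj a)) * (ratC s * (ratX - ratC a))
      = (1 - ratC (1 / a) * ratX) * (1 - ratC (cnj a) * ratX)"
  proof -
    define c where "c = cnj a"
    have c: "c \<noteq> 0" "s * s * a = c" using a ss by (simp_all add: c_def)
    then have "s * s = c / a" using a by (simp add: field_simps)
    then have "[:s:] * [:- (1 / c), 1:] * ([:s:] * [:- a, 1:]) = [:1, - (1 / a):] * [:1, - c:]"
      using a c(1) by (simp add: algebra_simps)
    then have "to_fract ([:s:] * [:- (1 / c), 1:] * ([:s:] * [:- a, 1:]))
        = to_fract ([:1, - (1 / a):] * [:1, - c:])"
      by simp
    then show ?thesis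
      unfolding c_def by (simp only: to_fract_mult) (simp add: to_fract_pCons ratC_uminus mult_ac)
  qed
  moreover have "1 - ratC (1 / a) * ratX \<noteq> 0"
    using zeta_factors_nonzero(2)[of "cnj (1 / a)"] by simp
  ultimately have "zeta \<alpha> (beta_pt \<alpha>) j * z\<alpha> j = 1"
    using a zeta_factors_nonzero(2)[of a] unfolding zeta_alpha_eq
    by (simp add: zeta_def beta_pt_def reflect_pt_def s_def flip: a_def)
  then show ?thesis
    by (metis inverse_unique mult.commute)
qed

lemma substar_zeta_alpha: "substar (z\<alpha> j) = inverse (z\<alpha> j)"
proof -
  define a s where "a = \<alpha> j" and "s = sigma (\<alpha> j)"
  have s: "ratC (cnj s) = inverse (ratC s)"
    using sigma_unit[of "\<alpha> j"] by (simp add: s_def flip: ratC_inverse) (metis inverse_unique mult.commute)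
  have X: "inverse ratX - ratC (cnj a) = (1 - ratC (cnj a) * ratX) / ratX"
    "1 - ratC a * inverse ratX = (ratX - ratC a) / ratX"
    by (simp_all add: field_simps)
  have "substar (z\<alpha> j) = ratC (cnj s) * (inverse ratX - ratC (cnj a)) / (1 - ratC a * inverse ratX)"
    unfolding zeta_alpha_eq by (simp add: substar_divide substar_mult substar_diff a_def s_def)
  also have "\<dots> = inverse (z\<alpha> j)"
    unfolding zeta_alpha_eq X s using zeta_factors_nonzero[of a]
    by (simp add: a_def s_def divide_inverse mult_ac)
  finally show ?thesis .
qed

text \<open>
  For \<open>z\<close> on the circle, \<open>1 - cnj a * z = z * cnj (z - a)\<close>.
\<close>

lemma circle_unimodular_zeta: "circle_unimodular (z\<alpha> j)"
  unfolding circle_unimodular_def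
proof (intro allI impI)
  fix z :: complex
  assume z: "cmod z = 1"
  define a where "a = \<alpha> j"
  have den: "1 - cnj a * z \<noteq> 0"
  proof
    assume "1 - cnj a * z = 0"
    then have "cmod (cnj a * z) = 1" by simp
    with z in_disk[of j] show False by (simp add: norm_mult a_def)
  qed
  have "1 - cnj a * z = z * cnj (z - a)"
    using z complex_norm_square[of z] by (simp add: algebra_simps)
  then have "cmod (1 - cnj a * z) = cmod (z - a)"
    using z by (metis complex_mod_cnj mult_1 norm_mult)
  moreover have "cmod (sigma a) = 1"
    by (simp add: sigma_def norm_divide)
  moreover have "z \<noteq> a"
    using z in_disk[of j] by (auto simp: a_def)
  ultimately have "cmod (sigma a * (z - a) / (1 - cnj a * z)) = 1"
    using den by (simp add: norm_mult norm_divide)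
  moreover have "has_value (1::ratfun) z 1"
    using has_value_ratC[of 1 z] by simp
  then have "has_value (z\<alpha> j) z (sigma a * (z - a) / (1 - cnj a * z))"
    unfolding zeta_alpha_eq a_def[symmetric]
    by (intro has_value_divide has_value_mult has_value_diff has_value_ratC has_value_ratX den)
  ultimately show "\<exists>v. has_value (z\<alpha> j) z v \<and> cmod v = 1" by blast
qed

text \<open>
  Each of the \<open>n\<close> indices contributes one linear numerator: that of the Blaschke factor if
  the index belongs to \<open>S\<close>, and otherwise the denominator needed for expansion.
\<close>

lemma zeta_prod_common_denominator:
  assumes "S \<subseteq> {1..n}"
  shows "\<exists>p. degree p \<le> n \<and>
    (\<Prod>j\<in>S. z\<alpha> j) = to_fract p * inverse (\<Prod>j\<in>{1..n}. 1 - ratC (cnj (\<alpha> j)) * ratX)"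
proof -
  define num den where "num j = [:sigma (\<alpha> j):] * [:- \<alpha> j, 1:]" and "den j = [:1, - cnj (\<alpha> j):]" for j
  have to_fract_prod: "to_fract (\<Prod>j\<in>A. f j) = (\<Prod>j\<in>A. to_fract (f j))"
    for A and f :: "nat \<Rightarrow> complex poly"
    by (induction A rule: infinite_finite_induct) simp_all
  define p where "p = (\<Prod>j\<in>S. num j) * (\<Prod>j\<in>{1..n} - S. den j)"
  have fin: "finite S" using assms finite_subset by blast
  have deg1: "degree (num j) \<le> 1" "degree (den j) \<le> 1" for j
    by (simp_all add: num_def den_def)
  have "degree p \<le> (\<Sum>j\<in>S. degree (num j)) + (\<Sum>j\<in>{1..n} - S. degree (den j))"
    unfolding p_def using fin
    by (intro order_trans[OF degree_mult_le] add_mono degree_prod_sum_le[unfolded o_def]) auto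
  also have "\<dots> \<le> (\<Sum>j\<in>S. 1) + (\<Sum>j\<in>{1..n} - S. 1)"
    by (intro add_mono sum_mono deg1)
  also have "\<dots> = n"
    using assms fin card_Diff_subset[OF fin assms] card_mono[OF _ assms] by simp
  finally have "degree p \<le> n" .
  have den: "to_fract (den j) = 1 - ratC (cnj (\<alpha> j)) * ratX" for j
    by (simp add: den_def linear_denominator_eq)
  have num: "to_fract (num j) = z\<alpha> j * to_fract (den j)" for j
  proof -
    have "to_fract (num j) = ratC (sigma (\<alpha> j)) * (ratX - ratC (\<alpha> j))"
      unfolding num_def to_fract_mult linear_numerator_eq[symmetric] ratC_def[symmetric] ..
    then show ?thesis
      unfolding zeta_alpha_eq den using zeta_factors_nonzero(2)[of "\<alpha> j"]
      by (simp del: right_minus_eq)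
  qed
  have "to_fract p = (\<Prod>j\<in>S. z\<alpha> j) * ((\<Prod>j\<in>S. to_fract (den j)) * (\<Prod>j\<in>{1..n} - S. to_fract (den j)))"
    by (simp add: p_def to_fract_prod num prod.distrib mult.assoc)
  also have "(\<Prod>j\<in>S. to_fract (den j)) * (\<Prod>j\<in>{1..n} - S. to_fract (den j)) = (\<Prod>j\<in>{1..n}. to_fract (den j))"
    using prod.subset_diff[OF assms, of "\<lambda>j. to_fract (den j)"] by (simp add: mult.commute)
  finally have "to_fract p = (\<Prod>j\<in>S. z\<alpha> j) * (\<Prod>j\<in>{1..n}. 1 - ratC (cnj (\<alpha> j)) * ratX)"
    by (simp add: den)
  moreover have "(\<Prod>j\<in>{1..n}. 1 - ratC (cnj (\<alpha> j)) * ratX) \<noteq> 0"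
    using zeta_factors_nonzero(2) by simp
  ultimately show ?thesis
    using \<open>degree p \<le> n\<close> by (intro exI[of _ p]) simp
qed

abbreviation admissible :: "(nat \<Rightarrow> sphere_pt) \<Rightarrow> bool" where
  "admissible \<gamma> \<equiv> \<forall>j. \<gamma> j \<in> {alpha_pt \<alpha> j, beta_pt \<alpha> j}"

abbreviation dot\<alpha> where "dot\<alpha> \<gamma> \<equiv> blaschke_dot \<alpha> \<gamma> (alpha_pt \<alpha>)"
abbreviation dot\<beta> where "dot\<beta> \<gamma> \<equiv> blaschke_dot \<alpha> \<gamma> (beta_pt \<alpha>)"

lemma dot_beta_eq: "dot\<beta> \<gamma> n = inverse (\<Prod>j\<in>{j\<in>{1..n}. \<gamma> j = beta_pt \<alpha> j}. z\<alpha> j)"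
  unfolding blaschke_dot_def zeta_beta_eq by (simp add: prod_inversef[symmetric] comp_def)

lemma dot_alpha_nonzero: "dot\<alpha> \<gamma> n \<noteq> 0"
  and dot_beta_nonzero: "dot\<beta> \<gamma> n \<noteq> 0"
  by (simp_all add: dot_beta_eq) (simp_all add: blaschke_dot_def zeta_alpha_nonzero)

lemma circle_unimodular_dot_alpha: "circle_unimodular (dot\<alpha> \<gamma> n)"
  unfolding blaschke_dot_def by (intro circle_unimodular_prod circle_unimodular_zeta)

lemma circle_unimodular_dot_beta: "circle_unimodular (dot\<beta> \<gamma> n)"
  unfolding dot_beta_eq
  by (intro circle_unimodular_inverse circle_unimodular_prod circle_unimodular_zeta)

lemma substar_dot_beta: "substar (dot\<beta> \<gamma> n) = inverse (dot\<beta> \<gamma> n)"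
  by (simp add: dot_beta_eq substar_inverse substar_prod substar_zeta_alpha prod_inversef[symmetric] comp_def)

lemma circle_regular_blaschke_gamma: "circle_regular (blaschke_gamma \<alpha> \<gamma> n)"
  unfolding blaschke_gamma_def
  by (simp add: circle_unimodular_regular circle_unimodular_dot_alpha circle_unimodular_dot_beta)

lemma dot_alpha_eq_blaschke_mult_dot_beta:
  assumes "admissible \<gamma>"
  shows "dot\<alpha> \<gamma> n = blaschke \<alpha> (alpha_pt \<alpha>) n * dot\<beta> \<gamma> n"
proof -
  define a b where "a = {j\<in>{1..n}. \<gamma> j = alpha_pt \<alpha> j}" and "b = {j\<in>{1..n}. \<gamma> j = beta_pt \<alpha> j}"
  have "{1..n} = a \<union> b" "a \<inter> b = {}"
    using assms alpha_neq_beta alpha_neq_beta[symmetric] by (auto simp: a_def b_def)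
  moreover have fin: "finite a" "finite b"
    by (simp_all add: a_def b_def)
  ultimately have "blaschke \<alpha> (alpha_pt \<alpha>) n = (\<Prod>j\<in>a. z\<alpha> j) * (\<Prod>j\<in>b. z\<alpha> j)"
    by (simp add: blaschke_def prod.union_disjoint)
  moreover have "dot\<alpha> \<gamma> n = (\<Prod>j\<in>a. z\<alpha> j)" "dot\<beta> \<gamma> n = inverse (\<Prod>j\<in>b. z\<alpha> j)"
    unfolding dot_beta_eq a_def b_def by (simp_all add: blaschke_dot_def)
  ultimately show ?thesis
    using fin by (simp add: zeta_alpha_nonzero)
qed

text \<open>
  Dividing by the product of all reciprocal factors up to \<open>n\<close> turns every generator into a
  product of distinct factors \<open>z\<alpha>\<close>. For a generator of type \<open>\<alpha>\<close> the missing
  factors come from the \<open>\<beta>\<close>-indices, which are disjoint from its own; for one of type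
  \<open>\<beta>\<close> those with index at most \<open>k\<close> cancel.
\<close>

lemma blaschke_gamma_div_dot_beta:
  assumes "admissible \<gamma>" "k \<le> n"
  obtains S where "S \<subseteq> {1..n}" "blaschke_gamma \<alpha> \<gamma> k = dot\<beta> \<gamma> n * (\<Prod>j\<in>S. z\<alpha> j)"
proof -
  define b where "b m = {j\<in>{1..m}. \<gamma> j = beta_pt \<alpha> j}" for m
  define a where "a = {j\<in>{1..k}. \<gamma> j = alpha_pt \<alpha> j}"
  have D: "dot\<beta> \<gamma> m = inverse (\<Prod>j\<in>b m. z\<alpha> j)" for m
    by (simp add: dot_beta_eq b_def)
  have b_fin: "finite (b m)" for m by (simp add: b_def)
  have nz: "(\<Prod>j\<in>b m. z\<alpha> j) \<noteq> 0" for m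
    by (simp add: zeta_alpha_nonzero b_fin)
  show thesis
  proof (cases "k \<noteq> 0 \<and> \<gamma> k = alpha_pt \<alpha> k")
    case True
    have "a \<inter> b n = {}"
      using alpha_neq_beta alpha_neq_beta[symmetric] by (auto simp: a_def b_def)
    then have "(\<Prod>j\<in>a \<union> b n. z\<alpha> j) = (\<Prod>j\<in>a. z\<alpha> j) * (\<Prod>j\<in>b n. z\<alpha> j)"
      by (intro prod.union_disjoint b_fin) (simp_all add: a_def)
    moreover have "blaschke_gamma \<alpha> \<gamma> k = (\<Prod>j\<in>a. z\<alpha> j)"
      using True by (simp add: blaschke_gamma_def blaschke_dot_def a_def)
    ultimately have "blaschke_gamma \<alpha> \<gamma> k = dot\<beta> \<gamma> n * (\<Prod>j\<in>a \<union> b n. z\<alpha> j)"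
      using nz by (simp add: D)
    then show thesis
      using assms(2) by (intro that[of "a \<union> b n"]) (auto simp: a_def b_def)
  next
    case False
    have B: "blaschke_gamma \<alpha> \<gamma> k = dot\<beta> \<gamma> k"
      using False by (auto simp: blaschke_gamma_def blaschke_dot_0)
    have "b k \<subseteq> b n"
      using assms(2) by (auto simp: b_def)
    then have "(\<Prod>j\<in>b n. z\<alpha> j) = (\<Prod>j\<in>b n - b k. z\<alpha> j) * (\<Prod>j\<in>b k. z\<alpha> j)"
      by (intro prod.subset_diff b_fin)
    then have "blaschke_gamma \<alpha> \<gamma> k = dot\<beta> \<gamma> n * (\<Prod>j\<in>b n - b k. z\<alpha> j)"
      using nz[of k] nz[of n] by (simp add: B D)
    then show thesis
      by (intro that[of "b n - b k"]) (auto simp: b_def)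
  qed
qed

text \<open>
  All choices that admit an orthonormal system lead to one and the same space of polynomial
  quotients, up to multiplication by the unimodular function \<open>dot\<beta> \<gamma> n\<close>.
\<close>

lemma rat_space_blaschke_gamma:
  assumes "admissible \<gamma>" "orthonormal_rational \<mu> (blaschke_gamma \<alpha> \<gamma>) \<phi>"
  shows "rat_space (blaschke_gamma \<alpha> \<gamma>) n = {to_fract p *
    (dot\<beta> \<gamma> n * inverse (\<Prod>j\<in>{1..n}. 1 - ratC (cnj (\<alpha> j)) * ratX)) | p. degree p \<le> n}"
proof (rule rat_space_eq_polynomial_multiples)
  fix k
  assume "k \<le> n"
  then obtain S where "S \<subseteq> {1..n}" "blaschke_gamma \<alpha> \<gamma> k = dot\<beta> \<gamma> n * (\<Prod>j\<in>S. z\<alpha> j)"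
    using blaschke_gamma_div_dot_beta assms(1) by blast
  then show "\<exists>p. degree p \<le> n \<and> blaschke_gamma \<alpha> \<gamma> k =
      to_fract p * (dot\<beta> \<gamma> n * inverse (\<Prod>j\<in>{1..n}. 1 - ratC (cnj (\<alpha> j)) * ratX))"
    using zeta_prod_common_denominator by (metis mult.left_commute)
next
  show "blaschke_gamma \<alpha> \<gamma> 0 \<noteq> 0"
    by (simp add: blaschke_gamma_def)
next
  show "blaschke_gamma \<alpha> \<gamma> (Suc k) \<notin> rat_space (blaschke_gamma \<alpha> \<gamma>) k" for k
    using orthonormal_rational_new_generator[OF assms(2)] .
qed

lemma rat_space_change_choice:
  assumes "admissible \<gamma>" "orthonormal_rational \<mu> (blaschke_gamma \<alpha> \<gamma>) \<phi>"
    and "admissible \<gamma>'" "orthonormal_rational \<mu> (blaschke_gamma \<alpha> \<gamma>') \<phi>'"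
    and f: "f \<in> rat_space (blaschke_gamma \<alpha> \<gamma>) n"
  shows "dot\<beta> \<gamma>' n / dot\<beta> \<gamma> n * f \<in> rat_space (blaschke_gamma \<alpha> \<gamma>') n"
proof -
  obtain p where "degree p \<le> n"
    "f = to_fract p * (dot\<beta> \<gamma> n * inverse (\<Prod>j\<in>{1..n}. 1 - ratC (cnj (\<alpha> j)) * ratX))"
    using f unfolding rat_space_blaschke_gamma[OF assms(1,2)] by blast
  then show ?thesis
    unfolding rat_space_blaschke_gamma[OF assms(3,4)] using dot_beta_nonzero[of \<gamma> n]
    by (intro CollectI exI[of _ p]) (simp add: mult_ac)
qed

text \<open>
  The factor that relates two choices at stage \<open>n + 1\<close> already relates the preceding spaces if
  the choices agree at \<open>n + 1\<close>. This makes multiplication by it respect orthogonality to the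
  preceding space.
\<close>

lemma dot_beta_ratio_Suc:
  assumes "\<gamma> (Suc n) = \<gamma>' (Suc n)"
  shows "dot\<beta> \<gamma>' (Suc n) / dot\<beta> \<gamma> (Suc n) = dot\<beta> \<gamma>' n / dot\<beta> \<gamma> n"
proof -
  have step: "dot\<beta> \<delta> (Suc n) =
      (if \<delta> (Suc n) = beta_pt \<alpha> (Suc n) then inverse (z\<alpha> (Suc n)) else 1) * dot\<beta> \<delta> n" for \<delta>
  proof -
    have "{j\<in>{1..Suc n}. \<delta> j = beta_pt \<alpha> j} =
        (if \<delta> (Suc n) = beta_pt \<alpha> (Suc n) then {Suc n} else {}) \<union> {j\<in>{1..n}. \<delta> j = beta_pt \<alpha> j}"
      by (auto simp: le_Suc_eq)
    then show ?thesis
      by (simp add: dot_beta_eq)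
  qed
  show ?thesis
    unfolding step[of \<gamma>] step[of \<gamma>'] assms by (simp add: zeta_alpha_nonzero)
qed

lemma blaschke_gamma_change_choice:
  assumes "admissible \<gamma>" "admissible \<gamma>'" "\<gamma> n = \<gamma>' n" "n \<noteq> 0"
  shows "blaschke_gamma \<alpha> \<gamma>' n = dot\<beta> \<gamma>' n / dot\<beta> \<gamma> n * blaschke_gamma \<alpha> \<gamma> n"
  using assms(3,4) dot_beta_nonzero[of \<gamma> n]
  by (simp add: blaschke_gamma_def dot_alpha_eq_blaschke_mult_dot_beta[OF assms(1)]
      dot_alpha_eq_blaschke_mult_dot_beta[OF assms(2)])

end

section \<open>Comparison of orthonormal systems\<close>

locale blaschke_measure = blaschke_points \<alpha> + circle_prob \<mu>
  for \<alpha> :: "nat \<Rightarrow> complex" and \<mu> :: "complex measure"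
begin

lemma orthonormal_rational_functionsI:
  "orthonormal_rational \<mu> (blaschke_gamma \<alpha> \<gamma>) \<phi> \<Longrightarrow>
     orthonormal_rational_functions \<mu> (blaschke_gamma \<alpha> \<gamma>) \<phi>"
  by unfold_locales (simp_all add: circle_regular_blaschke_gamma blaschke_gamma_def[of _ _ 0])

text \<open>
  The unimodular ratio \<open>u\<close> of the two products carries the \<open>n\<close>-th and the \<open>(n - 1)\<close>-st space of
  \<open>\<gamma>\<close> onto those of \<open>\<gamma>'\<close>, because the choices agree at \<open>n\<close>, and it is an isometry. So
  \<open>u \<phi>\<close> and \<open>\<phi>'\<close> satisfy the same orthonormality conditions and differ by a phase, which the
  normalization fixes: the factor \<open>u\<close> cancels in the normalized quantity, as it also relates
  the two Blaschke products and \<open>substar u = inverse u\<close>.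
\<close>

lemma phi_eq_if_same_choice:
  assumes \<gamma>: "admissible \<gamma>" "orthonormal_rational \<mu> (blaschke_gamma \<alpha> \<gamma>) \<phi>"
    and \<gamma>': "admissible \<gamma>'" "orthonormal_rational \<mu> (blaschke_gamma \<alpha> \<gamma>') \<phi>'"
    and same: "\<gamma> n = \<gamma>' n"
    and pos: "positive_at (superstar (blaschke_gamma \<alpha> \<gamma> n) (\<phi> n)) w"
    and pos': "positive_at (superstar (blaschke_gamma \<alpha> \<gamma>' n) (\<phi>' n)) w"
  shows "\<phi> n * dot\<beta> \<gamma>' n = \<phi>' n * dot\<beta> \<gamma> n"
proof (cases n)
  case 0
  then show ?thesis
    using \<gamma>(2) \<gamma>'(2) by (simp add: orthonormal_rational_def blaschke_dot_0)
next
  case (Suc m)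
  interpret F: orthonormal_rational_functions \<mu> "blaschke_gamma \<alpha> \<gamma>" \<phi>
    by (rule orthonormal_rational_functionsI[OF \<gamma>(2)])
  interpret F': orthonormal_rational_functions \<mu> "blaschke_gamma \<alpha> \<gamma>'" \<phi>'
    by (rule orthonormal_rational_functionsI[OF \<gamma>'(2)])
  define u where "u = dot\<beta> \<gamma>' n / dot\<beta> \<gamma> n"
  have u_nz: "u \<noteq> 0"
    by (simp add: u_def dot_beta_nonzero)
  have u: "circle_unimodular u"
    unfolding u_def divide_inverse
    by (intro circle_unimodular_mult circle_unimodular_inverse circle_unimodular_dot_beta)
  have u_star: "substar u = inverse u"
    by (simp add: u_def substar_divide substar_dot_beta dot_beta_nonzero field_simps)
  have u_prev: "u = dot\<beta> \<gamma>' m / dot\<beta> \<gamma> m"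
    using dot_beta_ratio_Suc same by (simp add: u_def Suc)
  have reg: "circle_regular (\<phi> n)"
    using F.phi_Suc_in F.regular_space Suc by blast
  have "u * \<phi> n \<in> rat_space (blaschke_gamma \<alpha> \<gamma>') (Suc m)"
    using rat_space_change_choice[OF \<gamma> \<gamma>' F.phi_Suc_in] by (simp add: u_def Suc)
  moreover have "rat_inner \<mu> (u * \<phi> n) g = 0" if g: "g \<in> rat_space (blaschke_gamma \<alpha> \<gamma>') m" for g
  proof -
    have h: "inverse u * g \<in> rat_space (blaschke_gamma \<alpha> \<gamma>) m"
      using rat_space_change_choice[OF \<gamma>' \<gamma> g] by (simp add: u_prev)
    have "rat_inner \<mu> (u * \<phi> n) (u * (inverse u * g)) = rat_inner \<mu> (\<phi> n) (inverse u * g)"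
      by (intro rat_inner_unimodular_mult u reg F.regular_space[OF h])
    also have "\<dots> = 0"
      using F.phi_Suc_orthogonal[OF h] Suc by simp
    finally show ?thesis
      using u_nz by (simp flip: mult.assoc)
  qed
  moreover have "rat_inner \<mu> (u * \<phi> n) (u * \<phi> n) = 1"
    using rat_inner_unimodular_mult[OF u reg reg] F.phi_normed by simp
  ultimately obtain c where c: "cmod c = 1" "u * \<phi> n = ratC c * \<phi>' (Suc m)"
    using F'.unique_up_to_phase by blast
  have "superstar (blaschke_gamma \<alpha> \<gamma> n) (\<phi> n)
      = u * blaschke_gamma \<alpha> \<gamma> n * (inverse u * substar (\<phi> n))"
    using u_nz by (simp add: superstar_def)
  also have "u * blaschke_gamma \<alpha> \<gamma> n = blaschke_gamma \<alpha> \<gamma>' n"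
    using blaschke_gamma_change_choice[OF \<gamma>(1) \<gamma>'(1) same] Suc by (simp add: u_def)
  also have "inverse u * substar (\<phi> n) = substar (u * \<phi> n)"
    by (simp add: substar_mult u_star)
  also have "\<dots> = ratC (cnj c) * substar (\<phi>' n)"
    using c(2) Suc by (simp add: substar_mult)
  finally have "superstar (blaschke_gamma \<alpha> \<gamma> n) (\<phi> n)
      = ratC (cnj c) * superstar (blaschke_gamma \<alpha> \<gamma>' n) (\<phi>' n)"
    by (simp add: superstar_def mult_ac)
  then have "cnj c = 1"
    using positive_at_scaleD[OF pos', of "cnj c"] pos c(1) by simp
  then have "u * \<phi> n = \<phi>' n"
    using c(2) Suc by (metis complex_cnj_cnj complex_cnj_one mult_1 ratC_1)
  then show ?thesis
    using dot_beta_nonzero[of \<gamma> n] by (auto simp: u_def field_simps)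
qed

lemma blaschke_gamma_alpha: "blaschke_gamma \<alpha> (alpha_pt \<alpha>) = blaschke \<alpha> (alpha_pt \<alpha>)"
  by (rule ext) (simp add: blaschke_gamma_def blaschke_dot_self, simp add: blaschke_def)

lemma blaschke_gamma_beta: "blaschke_gamma \<alpha> (beta_pt \<alpha>) = blaschke \<alpha> (beta_pt \<alpha>)"
  by (rule ext)
    (simp add: blaschke_gamma_def blaschke_dot_self alpha_neq_beta[symmetric], simp add: blaschke_def)

lemma blaschke_beta_eq: "blaschke \<alpha> (beta_pt \<alpha>) n = inverse (blaschke \<alpha> (alpha_pt \<alpha>) n)"
  unfolding blaschke_def zeta_beta_eq by (simp add: prod_inversef[symmetric] comp_def)

lemma substar_blaschke_alpha:
  "substar (blaschke \<alpha> (alpha_pt \<alpha>) n) = blaschke \<alpha> (beta_pt \<alpha>) n"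
  unfolding blaschke_beta_eq
  by (simp add: blaschke_def substar_prod substar_zeta_alpha prod_inversef[symmetric] comp_def)

lemma blaschke_alpha_nonzero: "blaschke \<alpha> (alpha_pt \<alpha>) n \<noteq> 0"
  by (simp add: blaschke_def zeta_alpha_nonzero)

text \<open>
  Conjugation interchanges the spaces of the two pure sequences and conjugates the inner
  product, so the conjugate of \<open>\<phi>\<alpha>\<close> agrees with \<open>\<phi>\<beta>\<close> up to a phase. It also carries
  positivity at \<open>\<alpha>\<^sub>n\<close> to positivity at the reflected point \<open>\<beta>\<^sub>n\<close>, which fixes the phase.
\<close>

lemma phi_beta_eq_substar_phi_alpha:
  assumes orth\<alpha>: "orthonormal_rational \<mu> (blaschke \<alpha> (alpha_pt \<alpha>)) \<phi>\<alpha>"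
    and orth\<beta>: "orthonormal_rational \<mu> (blaschke \<alpha> (beta_pt \<alpha>)) \<phi>\<beta>"
    and pos\<alpha>: "positive_at (superstar (blaschke \<alpha> (alpha_pt \<alpha>) n) (\<phi>\<alpha> n)) (alpha_pt \<alpha> n)"
    and pos\<beta>: "positive_at (superstar (blaschke \<alpha> (beta_pt \<alpha>) n) (\<phi>\<beta> n)) (beta_pt \<alpha> n)"
  shows "\<phi>\<beta> n = substar (\<phi>\<alpha> n)"
proof (cases n)
  case 0
  then show ?thesis
    using assms(1,2) by (simp add: orthonormal_rational_def)
next
  case (Suc m)
  interpret A: orthonormal_rational_functions \<mu> "blaschke \<alpha> (alpha_pt \<alpha>)" \<phi>\<alpha>
    using orthonormal_rational_functionsI[of "alpha_pt \<alpha>"] orth\<alpha> by (simp add: blaschke_gamma_alpha)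
  interpret B: orthonormal_rational_functions \<mu> "blaschke \<alpha> (beta_pt \<alpha>)" \<phi>\<beta>
    using orthonormal_rational_functionsI[of "beta_pt \<alpha>"] orth\<beta> by (simp add: blaschke_gamma_beta)
  have sB: "substar (blaschke \<alpha> (beta_pt \<alpha>) k) = blaschke \<alpha> (alpha_pt \<alpha>) k" for k
    by (metis substar_blaschke_alpha substar_substar)
  have reg: "circle_regular (\<phi>\<alpha> n)"
    using A.phi_Suc_in A.regular_space Suc by blast
  have "substar (\<phi>\<alpha> n) \<in> rat_space (blaschke \<alpha> (beta_pt \<alpha>)) (Suc m)"
    using substar_rat_space[OF A.phi_Suc_in substar_blaschke_alpha] Suc by simp
  moreover have "rat_inner \<mu> (substar (\<phi>\<alpha> n)) g = 0"
    if g: "g \<in> rat_space (blaschke \<alpha> (beta_pt \<alpha>)) m" for g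
  proof -
    have h: "substar g \<in> rat_space (blaschke \<alpha> (alpha_pt \<alpha>)) m"
      using substar_rat_space[OF g sB] .
    have "rat_inner \<mu> (substar (\<phi>\<alpha> n)) (substar (substar g)) = cnj (rat_inner \<mu> (\<phi>\<alpha> n) (substar g))"
      by (intro rat_inner_substar reg A.regular_space[OF h])
    then show ?thesis
      using A.phi_Suc_orthogonal[OF h] Suc by simp
  qed
  moreover have "rat_inner \<mu> (substar (\<phi>\<alpha> n)) (substar (\<phi>\<alpha> n)) = 1"
    using rat_inner_substar[OF reg reg] A.phi_normed by simp
  ultimately obtain c where c: "cmod c = 1" "substar (\<phi>\<alpha> n) = ratC c * \<phi>\<beta> (Suc m)"
    using B.unique_up_to_phase by blast
  have "substar (superstar (blaschke \<alpha> (alpha_pt \<alpha>) n) (\<phi>\<alpha> n))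
      = blaschke \<alpha> (beta_pt \<alpha>) n * substar (substar (\<phi>\<alpha> n))"
    by (simp only: superstar_def substar_mult substar_blaschke_alpha)
  also have "substar (substar (\<phi>\<alpha> n)) = ratC (cnj c) * substar (\<phi>\<beta> n)"
    by (subst c(2)) (simp add: substar_mult Suc)
  also have "blaschke \<alpha> (beta_pt \<alpha>) n * (ratC (cnj c) * substar (\<phi>\<beta> n))
      = ratC (cnj c) * superstar (blaschke \<alpha> (beta_pt \<alpha>) n) (\<phi>\<beta> n)"
    by (simp add: superstar_def mult_ac)
  finally have "positive_at (ratC (cnj c) * superstar (blaschke \<alpha> (beta_pt \<alpha>) n) (\<phi>\<beta> n)) (beta_pt \<alpha> n)"
    using positive_at_substar pos\<alpha> by (metis alpha_pt_def beta_pt_def)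
  then have "cnj c = 1"
    using positive_at_scaleD[OF pos\<beta>, of "cnj c"] c(1) by simp
  then show ?thesis
    using c(2) Suc by (metis complex_cnj_cnj complex_cnj_one mult_1 ratC_1)
qed

end

section \<open>The orthogonal rational functions for mixed poles\<close>

theorem theorem3p9:
  fixes \<alpha> :: "nat \<Rightarrow> complex"
    and \<gamma> :: "nat \<Rightarrow> sphere_pt"
    and \<mu> :: "complex measure"
    and \<phi>\<alpha> \<phi>\<beta> \<phi> :: "nat \<Rightarrow> ratfun"
  defines "\<beta> \<equiv> beta_pt \<alpha>"
    and "B\<alpha> \<equiv> blaschke \<alpha> (alpha_pt \<alpha>)"
    and "B\<beta> \<equiv> blaschke \<alpha> (beta_pt \<alpha>)"
    and "D\<alpha> \<equiv> blaschke_dot \<alpha> \<gamma> (alpha_pt \<alpha>)"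
    and "D\<beta> \<equiv> blaschke_dot \<alpha> \<gamma> (beta_pt \<alpha>)"
  defines "\<phi>\<alpha>s \<equiv> \<lambda>n. superstar (B\<alpha> n) (\<phi>\<alpha> n)"
    and "\<phi>\<beta>s \<equiv> \<lambda>n. superstar (B\<beta> n) (\<phi>\<beta> n)"
    and "\<phi>s \<equiv> \<lambda>n. superstar (D\<alpha> n * D\<beta> n) (\<phi> n)"
  assumes "\<alpha> 0 = 0"
    and "\<And>j. j \<ge> 1 \<Longrightarrow> \<alpha> j \<in> ball 0 1"
    and "\<And>j. \<gamma> j \<in> {Pt (\<alpha> j), \<beta> j}"
    and "circle_prob_positive_ae \<mu>"
    and "orthonormal_rational \<mu> B\<alpha> \<phi>\<alpha>"
    and "orthonormal_rational \<mu> B\<beta> \<phi>\<beta>"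
    and "orthonormal_rational \<mu> (blaschke_gamma \<alpha> \<gamma>) \<phi>"
    and "\<And>n. positive_at (\<phi>\<alpha>s n) (Pt (\<alpha> n))"
    and "\<And>n. positive_at (\<phi>\<beta>s n) (\<beta> n)"
    and "\<And>n. \<gamma> n = Pt (\<alpha> n) \<Longrightarrow> positive_at (\<phi>s n / D\<beta> n) (Pt (\<alpha> n))"
    and "\<And>n. \<gamma> n = \<beta> n \<Longrightarrow> positive_at (\<phi>s n / D\<alpha> n) (\<beta> n)"
  shows "\<forall>n.
    (\<gamma> n = Pt (\<alpha> n) \<longrightarrow>
       \<phi> n = \<phi>\<alpha> n * D\<beta> n \<and> \<phi> n = \<phi>\<beta>s n * D\<alpha> n \<and>
       \<phi>s n = \<phi>\<alpha>s n * D\<beta> n \<and> \<phi>s n = \<phi>\<beta> n * D\<alpha> n) \<and>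
    (\<gamma> n = \<beta> n \<longrightarrow>
       \<phi> n = \<phi>\<beta> n * D\<alpha> n \<and> \<phi> n = \<phi>\<alpha>s n * D\<beta> n \<and>
       \<phi>s n = \<phi>\<beta>s n * D\<alpha> n \<and> \<phi>s n = \<phi>\<alpha> n * D\<beta> n)"
proof -
  have disk: "cmod (\<alpha> j) < 1" for j
    using assms(9) assms(10)[of j] by (cases "j = 0") auto
  interpret blaschke_measure \<alpha> \<mu>
    using assms(12) disk
    by (intro blaschke_measure.intro blaschke_points.intro circle_prob.intro circle_prob_axioms.intro)
      (simp_all add: circle_prob_positive_ae_def)
  note adm = assms(11)[unfolded \<beta>_def, folded alpha_pt_def]
  have admissible: "\<forall>j. \<gamma> j \<in> {alpha_pt \<alpha> j, beta_pt \<alpha> j}"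
    using adm by blast
  have reflect: "\<phi>\<beta> n = substar (\<phi>\<alpha> n)" "\<phi>\<alpha> n = substar (\<phi>\<beta> n)" for n
  proof -
    show "\<phi>\<beta> n = substar (\<phi>\<alpha> n)"
      using assms(13,14) assms(16,17)[of n] unfolding B\<alpha>_def B\<beta>_def \<phi>\<alpha>s_def \<phi>\<beta>s_def \<beta>_def
      by (intro phi_beta_eq_substar_phi_alpha) (simp_all add: alpha_pt_def)
    then show "\<phi>\<alpha> n = substar (\<phi>\<beta> n)" by simp
  qed
  have D_nz: "D\<alpha> n \<noteq> 0" "D\<beta> n \<noteq> 0" for n
    by (simp_all add: D\<alpha>_def D\<beta>_def dot_alpha_nonzero dot_beta_nonzero)
  have DB: "D\<alpha> n = B\<alpha> n * D\<beta> n" for n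
    unfolding D\<alpha>_def D\<beta>_def B\<alpha>_def by (rule dot_alpha_eq_blaschke_mult_dot_beta[OF admissible])
  have B\<beta>: "B\<beta> n = inverse (B\<alpha> n)" and B_nz: "B\<alpha> n \<noteq> 0" for n
    by (simp_all add: B\<alpha>_def B\<beta>_def blaschke_beta_eq blaschke_alpha_nonzero)
  have D\<beta>_star: "substar (D\<beta> n) = inverse (D\<beta> n)" for n
    by (simp add: D\<beta>_def substar_dot_beta)
  have B\<alpha>_star: "substar (B\<alpha> n) = inverse (B\<alpha> n)" for n
    by (simp add: B\<alpha>_def substar_blaschke_alpha blaschke_beta_eq)
  have D\<alpha>_star: "substar (D\<alpha> n) = inverse (D\<alpha> n)" for n
    by (simp add: DB substar_mult B\<alpha>_star D\<beta>_star)
  \<comment> \<open>The pure sequence \<open>\<alpha>\<close> is itself a choice; its product of reciprocal factors is empty.\<close>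
  have alpha: "\<phi> n = \<phi>\<alpha> n * D\<beta> n" if \<gamma>: "\<gamma> n = Pt (\<alpha> n)" for n
  proof -
    have \<gamma>': "\<gamma> n = alpha_pt \<alpha> n"
      using \<gamma> by (simp add: alpha_pt_def)
    then have gam: "blaschke_gamma \<alpha> \<gamma> n = D\<alpha> n"
      by (simp add: blaschke_gamma_def D\<alpha>_def blaschke_dot_0)
    have "\<phi>s n / D\<beta> n = superstar (blaschke_gamma \<alpha> \<gamma> n) (\<phi> n)"
      using D_nz[of n] by (simp add: \<phi>s_def superstar_def gam)
    then have "positive_at (superstar (blaschke_gamma \<alpha> \<gamma> n) (\<phi> n)) (Pt (\<alpha> n))"
      using assms(18)[OF \<gamma>] by simp
    moreover have "positive_at (superstar (blaschke_gamma \<alpha> (alpha_pt \<alpha>) n) (\<phi>\<alpha> n)) (Pt (\<alpha> n))"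
      using assms(16)[of n] by (simp add: \<phi>\<alpha>s_def B\<alpha>_def blaschke_gamma_alpha)
    ultimately have "\<phi> n * blaschke_dot \<alpha> (alpha_pt \<alpha>) (beta_pt \<alpha>) n = \<phi>\<alpha> n * D\<beta> n"
      unfolding D\<beta>_def
      using \<gamma>' assms(13,15) admissible
      by (intro phi_eq_if_same_choice) (simp_all add: B\<alpha>_def blaschke_gamma_alpha)
    then show ?thesis
      using alpha_neq_beta by (simp add: blaschke_dot_def)
  qed
  \<comment> \<open>For the pure sequence \<open>\<beta>\<close> the product of reciprocal factors is all of \<open>B\<beta> n\<close>.\<close>
  have beta: "\<phi> n = \<phi>\<beta> n * D\<alpha> n" if \<gamma>: "\<gamma> n = \<beta> n" for n
  proof -
    have "\<gamma> n \<noteq> alpha_pt \<alpha> n"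
      using \<gamma> alpha_neq_beta[of n] by (simp add: \<beta>_def)
    then have gam: "blaschke_gamma \<alpha> \<gamma> n = D\<beta> n"
      by (simp add: blaschke_gamma_def D\<beta>_def blaschke_dot_0)
    have "\<phi>s n / D\<alpha> n = superstar (blaschke_gamma \<alpha> \<gamma> n) (\<phi> n)"
      using D_nz[of n] by (simp add: \<phi>s_def superstar_def gam)
    then have "positive_at (superstar (blaschke_gamma \<alpha> \<gamma> n) (\<phi> n)) (\<beta> n)"
      using assms(19)[OF \<gamma>] by simp
    moreover have "positive_at (superstar (blaschke_gamma \<alpha> (beta_pt \<alpha>) n) (\<phi>\<beta> n)) (\<beta> n)"
      using assms(17)[of n] by (simp add: \<phi>\<beta>s_def B\<beta>_def blaschke_gamma_beta)
    ultimately have "\<phi> n * blaschke_dot \<alpha> (beta_pt \<alpha>) (beta_pt \<alpha>) n = \<phi>\<beta> n * D\<beta> n"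
      unfolding D\<beta>_def
      using \<gamma> assms(14,15) admissible
      by (intro phi_eq_if_same_choice) (simp_all add: B\<beta>_def blaschke_gamma_beta \<beta>_def)
    moreover have "blaschke_dot \<alpha> (beta_pt \<alpha>) (beta_pt \<alpha>) n = B\<beta> n"
      by (simp add: blaschke_dot_self B\<beta>_def)
    ultimately show ?thesis
      using B_nz[of n] by (simp add: B\<beta> DB field_simps)
  qed
  \<comment> \<open>All remaining identities follow from \<open>\<phi>\<beta> = substar \<phi>\<alpha>\<close> and \<open>D\<alpha> = B\<alpha> D\<beta>\<close>.\<close>
  have "\<phi> n = \<phi>\<beta>s n * D\<alpha> n" "\<phi>s n = \<phi>\<alpha>s n * D\<beta> n" "\<phi>s n = \<phi>\<beta> n * D\<alpha> n"
    if "\<gamma> n = Pt (\<alpha> n)" for n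
    using D_nz[of n] B_nz[of n]
    by (simp_all add: alpha[OF that] \<phi>s_def \<phi>\<alpha>s_def \<phi>\<beta>s_def superstar_def substar_mult D\<beta>_star
        B\<beta> DB reflect(1))
  moreover have "\<phi> n = \<phi>\<alpha>s n * D\<beta> n" "\<phi>s n = \<phi>\<beta>s n * D\<alpha> n" "\<phi>s n = \<phi>\<alpha> n * D\<beta> n"
    if "\<gamma> n = \<beta> n" for n
    using D_nz[of n] B_nz[of n]
    by (simp_all add: beta[OF that] \<phi>s_def \<phi>\<alpha>s_def \<phi>\<beta>s_def superstar_def substar_mult D\<alpha>_star
        B\<beta> reflect(1)) (simp_all add: DB)
  ultimately show ?thesis
    using alpha beta by blast
qed

end
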